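(* Let $X$ and $Y$ be essentially incomparable Banach spaces, put $Z=X\oplus Y$, and let $A,B\in\mathcal B(Z)$. If $I_Z-AB$ is invertible, then $I_Z-BA$ is invertible and $$\varphi(I_Z-AB)=\varphi(I_Z-BA).$$ Consequently, if $I_Z-BA\in\operatorname{Inv}_0(\mathcal B(Z))$, then $\varphi(I_Z-AB)=0$.
   Context: Banach spaces are complex. $\mathcal B(X,Y)$ is the space of bounded operators $X\to Y$, $\mathcal B(X)=\mathcal B(X,X)$. An operator is Fredholm if it has closed range, finite-dimensional kernel and range of finite codimension; its index is $\operatorname{ind}T=\dim\operatorname{Ker}T-\dim(\text{codomain}/\operatorname{Ran}T)$. An operator $R\in\mathcal B(X,Y)$ is inessential if $I_X-VR$ is Fredholm for every $V\in\mathcal B(Y,X)$; the set of these is $\mathcal E(X,Y)$. $X$ and $Y$ are essentially incomparable if $\mathcal B(X,Y)=\mathcal E(X,Y)$ and $\mathcal B(Y,X)=\mathcal E(Y,X)$. Write $U\in\mathcal B(X\oplus Y)$ as an operator matrix $U=\begin{pmatrix} U_{11} & U_{12} \\ U_{21} & U_{22} \end{pmatrix}$. When $X,Y$ are essentially incomparable and $U$ is invertible, $U_{11}\in\mathcal B(X)$ is Fredholm, and one defines $\varphi:\operatorname{Inv}(\mathcal B(Z))\to\mathbb Z$ by $\varphi(U)=\operatorname{ind}U_{11}$. For a unital Banach algebra $A$, $\operatorname{Inv}(A)$ is the group of invertible elements and $\operatorname{Inv}_0(A)$ the connected component of $1_A$ in it. *)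

theory Defs
  imports "HOL-Analysis.Analysis" "HOL-Library.Set_Algebras"
begin

section \<open>Complex Banach spaces\<close>

class scaleC =
  fixes scaleC :: "complex \<Rightarrow> 'a \<Rightarrow> 'a" (infixr \<open>*\<^sub>C\<close> 75)

class complex_vector = real_vector + scaleC +
  assumes scaleC_add_right: "a *\<^sub>C (x + y) = a *\<^sub>C x + a *\<^sub>C y"
    and scaleC_add_left: "(a + b) *\<^sub>C x = a *\<^sub>C x + b *\<^sub>C x"
    and scaleC_scaleC: "a *\<^sub>C (b *\<^sub>C x) = (a * b) *\<^sub>C x"
    and scaleC_one: "1 *\<^sub>C x = x"
    and scaleR_scaleC: "r *\<^sub>R x = complex_of_real r *\<^sub>C x"

class complex_normed_vector = complex_vector + real_normed_vector +
  assumes norm_scaleC: "norm (a *\<^sub>C x) = cmod a * norm x"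

class cbanach = complex_normed_vector + banach

text \<open>The library norm on a product type is the Euclidean combination of the two norms; it is one
  of the equivalent complete norms on the direct sum, and nothing below depends on that choice.\<close>

instantiation prod :: (scaleC, scaleC) scaleC
begin

definition scaleC_prod_def: "a *\<^sub>C p = (a *\<^sub>C fst p, a *\<^sub>C snd p)"

instance ..

end

instance prod :: (complex_vector, complex_vector) complex_vector
  by standard
    (simp_all add: scaleC_prod_def scaleR_prod_def scaleC_add_right scaleC_add_left scaleC_scaleC
      scaleC_one scaleR_scaleC)

instance prod :: (complex_normed_vector, complex_normed_vector) complex_normed_vector
proof
  fix a :: complex and x :: "'a \<times> 'b"
  have "(cmod a * norm (fst x))\<^sup>2 + (cmod a * norm (snd x))\<^sup>2
      = (cmod a)\<^sup>2 * ((norm (fst x))\<^sup>2 + (norm (snd x))\<^sup>2)"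
    by (simp add: power_mult_distrib distrib_left)
  then show "norm (a *\<^sub>C x) = cmod a * norm x"
    by (simp add: norm_prod_def scaleC_prod_def norm_scaleC real_sqrt_mult)
qed

instance prod :: (cbanach, cbanach) cbanach ..

global_interpretation complex_vector: vector_space "scaleC :: complex \<Rightarrow> 'a \<Rightarrow> 'a::complex_vector"
  defines cspan = complex_vector.span
    and cdim = complex_vector.dim
  by unfold_locales (simp_all add: scaleC_add_right scaleC_add_left scaleC_scaleC scaleC_one)

section \<open>Bounded complex-linear operators\<close>

text \<open>\<open>'a \<Rightarrow>\<^sub>L 'b\<close> consists of the bounded real-linear maps with the operator norm; the bounded
  complex-linear ones are a closed subspace of it, with the same norm.\<close>

definition bounded_ops :: "('a::complex_normed_vector \<Rightarrow>\<^sub>L 'b::complex_normed_vector) set" where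
  "bounded_ops = {T. \<forall>c x. blinfun_apply T (c *\<^sub>C x) = c *\<^sub>C blinfun_apply T x}"

definition Inv :: "('a::complex_normed_vector \<Rightarrow>\<^sub>L 'a) set" where
  "Inv = {U \<in> bounded_ops. \<exists>V\<in>bounded_ops. U o\<^sub>L V = id_blinfun \<and> V o\<^sub>L U = id_blinfun}"

definition Inv0 :: "('a::complex_normed_vector \<Rightarrow>\<^sub>L 'a) set" where
  "Inv0 = connected_component_set Inv id_blinfun"

section \<open>Quotient by a subspace and its dimension\<close>

definition quotient_space :: "'a::complex_vector set \<Rightarrow> 'a set set" where
  "quotient_space W = range (\<lambda>y. {y} + W)"

text \<open>Linear combinations in the quotient are written with Minkowski sums and dilates of cosets.
  The final summand \<open>W\<close> is the zero of the quotient; it makes the empty combination and the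
  coefficient \<open>0\<close> come out right (the literal dilate of a coset by \<open>0\<close> is \<open>{0}\<close>, not \<open>W\<close>).\<close>

definition quotient_comb ::
    "'a::complex_vector set \<Rightarrow> ('a set \<Rightarrow> complex) \<Rightarrow> 'a set set \<Rightarrow> 'a set" where
  "quotient_comb W u Q = (\<Sum>q\<in>Q. scaleC (u q) ` q) + W"

lemma quotient_comb_cosets:
  assumes W: "complex_vector.subspace W" and "finite I" and inj: "inj_on (\<lambda>i. {y i} + W) I"
  shows "quotient_comb W u ((\<lambda>i. {y i} + W) ` I) = {\<Sum>i\<in>I. u ({y i} + W) *\<^sub>C y i} + W"
proof -
  let ?q = "\<lambda>i. {y i} + W"
  have absorb: "D + W = W" if "D \<subseteq> W" "D \<noteq> {}" for D
  proof
    show "D + W \<subseteq> W"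
      using that complex_vector.subspace_add[OF W] by (auto simp: set_plus_def)
    show "W \<subseteq> D + W"
    proof
      fix w assume "w \<in> W"
      from that obtain d where d: "d \<in> D" by blast
      with that \<open>w \<in> W\<close> have "w - d \<in> W"
        using complex_vector.subspace_diff[OF W] by blast
      with d show "w \<in> D + W"
        using set_plus_intro[of d D "w - d" W] by simp
    qed
  qed
  have dil: "scaleC c ` ({z} + W) = {c *\<^sub>C z} + scaleC c ` W" for c z
    by (force simp: set_plus_def image_iff scaleC_add_right)
  have scale: "scaleC c ` ({z} + W) + W = {c *\<^sub>C z} + W" for c z
    unfolding dil add.assoc
    by (subst absorb) (use complex_vector.subspace_scale[OF W] complex_vector.subspace_0[OF W] in auto)
  have "(\<Sum>i\<in>J. scaleC (u (?q i)) ` ?q i) + W = {\<Sum>i\<in>J. u (?q i) *\<^sub>C y i} + W"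
    if "finite J" for J
    using that
  proof (induction J rule: finite_induct)
    case empty
    then show ?case by (simp add: set_zero)
  next
    case (insert j J)
    let ?d = "scaleC (u (?q j)) ` ?q j"
    have "(\<Sum>i\<in>insert j J. scaleC (u (?q i)) ` ?q i) + W
        = ?d + ((\<Sum>i\<in>J. scaleC (u (?q i)) ` ?q i) + W)"
      using insert by (simp add: add.assoc)
    also have "\<dots> = {\<Sum>i\<in>J. u (?q i) *\<^sub>C y i} + (?d + W)"
      by (simp only: insert.IH add.left_commute)
    also have "\<dots> = ({\<Sum>i\<in>J. u (?q i) *\<^sub>C y i} + {u (?q j) *\<^sub>C y j}) + W"
      by (simp only: scale add.assoc)
    also have "{\<Sum>i\<in>J. u (?q i) *\<^sub>C y i} + {u (?q j) *\<^sub>C y j}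
        = {\<Sum>i\<in>insert j J. u (?q i) *\<^sub>C y i}"
      using insert by (simp add: set_plus_def add.commute)
    finally show ?case .
  qed
  then show ?thesis
    using assms(2) by (simp add: quotient_comb_def sum.reindex[OF inj])
qed

definition quotient_basis :: "'a::complex_vector set \<Rightarrow> 'a set set \<Rightarrow> bool" where
  "quotient_basis W Q \<longleftrightarrow> finite Q \<and> Q \<subseteq> quotient_space W \<and>
     (\<forall>p\<in>quotient_space W. \<exists>!u. (\<forall>q. q \<notin> Q \<longrightarrow> u q = 0) \<and> quotient_comb W u Q = p)"

definition finite_codim :: "'a::complex_vector set \<Rightarrow> bool" where
  "finite_codim W \<longleftrightarrow> (\<exists>Q. quotient_basis W Q)"

definition codim :: "'a::complex_vector set \<Rightarrow> nat" where
  "codim W = card (SOME Q. quotient_basis W Q)"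

section \<open>Fredholm and inessential operators\<close>

definition ker :: "('a::complex_normed_vector \<Rightarrow>\<^sub>L 'b::complex_normed_vector) \<Rightarrow> 'a set" where
  "ker T = {x. blinfun_apply T x = 0}"

definition Fredholm :: "('a::complex_normed_vector \<Rightarrow>\<^sub>L 'b::complex_normed_vector) \<Rightarrow> bool" where
  "Fredholm T \<longleftrightarrow> T \<in> bounded_ops \<and> closed (range (blinfun_apply T)) \<and>
     (\<exists>F. finite F \<and> ker T = cspan F) \<and> finite_codim (range (blinfun_apply T))"

text \<open>Meaningful only when \<open>T\<close> is Fredholm.\<close>

definition ind :: "('a::complex_normed_vector \<Rightarrow>\<^sub>L 'b::complex_normed_vector) \<Rightarrow> int" where
  "ind T = int (cdim (ker T)) - int (codim (range (blinfun_apply T)))"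

definition inessential_ops :: "('a::cbanach \<Rightarrow>\<^sub>L 'b::cbanach) set" where
  "inessential_ops = {R \<in> bounded_ops. \<forall>V\<in>bounded_ops. Fredholm (id_blinfun - (V o\<^sub>L R))}"

definition essentially_incomparable :: "'a::cbanach itself \<Rightarrow> 'b::cbanach itself \<Rightarrow> bool" where
  "essentially_incomparable X Y \<longleftrightarrow>
     (bounded_ops :: ('a \<Rightarrow>\<^sub>L 'b) set) = inessential_ops \<and>
     (bounded_ops :: ('b \<Rightarrow>\<^sub>L 'a) set) = inessential_ops"

section \<open>The upper left corner of an operator matrix\<close>

lift_definition corner11 ::
    "('a::cbanach \<times> 'b::cbanach) \<Rightarrow>\<^sub>L ('a \<times> 'b) \<Rightarrow> 'a \<Rightarrow>\<^sub>L 'a" is "\<lambda>U x. fst (U (x, 0))"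
  by (auto intro!: bounded_linear_intros intro: bounded_linear_compose)

definition \<phi> :: "('a::cbanach \<times> 'b::cbanach) \<Rightarrow>\<^sub>L ('a \<times> 'b) \<Rightarrow> int" where
  "\<phi> U = ind (corner11 U)"

end

theory Submission
  imports Defs
begin

text \<open>
  Write \<open>U\<^sub>i\<^sub>j\<close> for the blocks of an operator \<open>U\<close> on \<open>X \<oplus> Y\<close>.  The upper left corner of
  \<open>I - AB\<close> is \<open>I - A\<^sub>1\<^sub>1 B\<^sub>1\<^sub>1 - A\<^sub>1\<^sub>2 B\<^sub>2\<^sub>1\<close>.  The term \<open>A\<^sub>1\<^sub>2 B\<^sub>2\<^sub>1\<close> factors through
  \<open>Y\<close> and is therefore inessential, so that it does not affect the index
  (\<open>ind_corner11_perturbed\<close>), and \<open>\<phi> (I - AB) = ind (I - A\<^sub>1\<^sub>1 B\<^sub>1\<^sub>1)\<close>.  By the same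
  argument \<open>\<phi> (I - BA) = ind (I - B\<^sub>1\<^sub>1 A\<^sub>1\<^sub>1)\<close>.  These two indices agree for the algebraic
  reason that \<open>B\<^sub>1\<^sub>1\<close> maps the kernel of the one operator isomorphically to that of the other, and
  likewise a complement of the range (\<open>ind_swap\<close>).

  The index is insensitive to an inessential term because it is constant on connected families of
  Fredholm operators (\<open>ind_constant_on_connected\<close>).  It is applied to the segment
  \<open>U\<^sub>1\<^sub>1 + t A\<^sub>1\<^sub>2 B\<^sub>2\<^sub>1\<close> with \<open>U = I - AB\<close>.  If \<open>V\<close> is the inverse of \<open>U\<close>, then
  multiplying a member of this segment by \<open>V\<^sub>1\<^sub>1\<close> on either side gives the identity minus a sum of two
  products through \<open>Y\<close>, and such an operator is Fredholm (\<open>finite_defects_inessential_sum\<close>).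
  The same constancy, applied to a connected set of invertible operators that contains \<open>I\<close> and
  \<open>I - BA\<close>, gives \<open>\<phi> (I - BA) = 0\<close> for the second claim.

  Local constancy of the index (\<open>ind_locally_constant\<close>) rests on the fact that the index of
  \<open>T\<close> can be computed from any decomposition of the domain as \<open>L \<oplus> N\<close> and of the target as
  \<open>T L \<oplus> C\<close> with \<open>T\<close> injective on \<open>L\<close> and with \<open>N\<close>, \<open>C\<close> of finite dimension:
  it is \<open>dim N - dim C\<close> (\<open>ind_by_restriction\<close>).  With \<open>L\<close> closed, the open mapping theorem
  makes \<open>(l, c) \<mapsto> T l + c\<close> an isomorphism of \<open>L \<times> C\<close> onto the target, and this is
  stable under small perturbations of \<open>T\<close>.  A closed complement \<open>L\<close> of the
  finite-dimensional kernel is provided by the Hahn-Banach theorem.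
\<close>

section \<open>Linear algebra of complementary subspaces\<close>

interpretation clin: vector_space_pair
  "scaleC :: complex \<Rightarrow> 'a::complex_vector \<Rightarrow> 'a" "scaleC :: complex \<Rightarrow> 'b::complex_vector \<Rightarrow> 'b"
  by unfold_locales

abbreviation csubspace :: "'a::complex_vector set \<Rightarrow> bool" where
  "csubspace \<equiv> complex_vector.subspace"

abbreviation clinear :: "('a::complex_vector \<Rightarrow> 'b::complex_vector) \<Rightarrow> bool" where
  "clinear \<equiv> Vector_Spaces.linear scaleC scaleC"

lemma clinearI:
  assumes "\<And>x y. f (x + y) = f x + f y" and "\<And>c x. f (c *\<^sub>C x) = c *\<^sub>C f x"
  shows "clinear f"
  using assms by (simp add: Vector_Spaces.linear_iff complex_vector.vector_space_axioms)

lemma csubspace_plus: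
  assumes "csubspace A" and "csubspace B"
  shows "csubspace (A + B)"
proof -
  have "A + B = {x + y |x y. x \<in> A \<and> y \<in> B}"
    by (auto simp: set_plus_def)
  then show ?thesis
    using complex_vector.subspace_sums[OF assms] by simp
qed

definition fin_dim :: "'a::complex_vector set \<Rightarrow> bool" where
  "fin_dim N \<longleftrightarrow> (\<exists>F. finite F \<and> N = cspan F)"

lemma fin_dim_subspace: "fin_dim N \<Longrightarrow> csubspace N"
  by (auto simp: fin_dim_def)

lemma fin_dim_zero: "fin_dim {0}"
  unfolding fin_dim_def by (intro exI[of _ "{}"]) simp

lemma fin_dim_subset:
  assumes "fin_dim N" and M: "csubspace M" "M \<subseteq> N"
  shows "fin_dim M"
proof -
  obtain F where F: "finite F" "N = cspan F"
    using assms by (auto simp: fin_dim_def)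
  obtain B where B: "B \<subseteq> M" "complex_vector.independent B" "M \<subseteq> cspan B"
    by (rule complex_vector.basis_exists)
  moreover have "finite B"
    using complex_vector.independent_span_bound[OF F(1) B(2)] B(1) M F by auto
  ultimately show ?thesis
    unfolding fin_dim_def using complex_vector.span_subspace[OF B(1,3) M(1)] by blast
qed

lemma fin_dim_basis:
  assumes "fin_dim N"
  obtains B where "finite B" "complex_vector.independent B" "N = cspan B" "card B = cdim N"
proof -
  obtain F where F: "finite F" "N = cspan F"
    using assms by (auto simp: fin_dim_def)
  obtain B where B: "B \<subseteq> N" "complex_vector.independent B" "N \<subseteq> cspan B" "card B = cdim N"
    by (rule complex_vector.basis_exists)
  have "finite B"
    using complex_vector.independent_span_bound[OF F(1) B(2)] B(1) F by auto
  then show thesis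
    using that B complex_vector.span_subspace[OF B(1,3) fin_dim_subspace[OF assms]] by metis
qed

lemma fin_dim_image: "clinear f \<Longrightarrow> fin_dim N \<Longrightarrow> fin_dim (f ` N)"
  unfolding fin_dim_def by (metis clin.linear_span_image finite_imageI)

lemma cdim_inj_image:
  assumes f: "clinear f" and N: "fin_dim N" and inj: "inj_on f N"
  shows "cdim (f ` N) = cdim N"
proof -
  obtain B where B: "finite B" "complex_vector.independent B" "N = cspan B" "card B = cdim N"
    using fin_dim_basis[OF N] by metis
  have "complex_vector.independent (f ` B)"
    using clin.linear_independent_injective_image[OF f B(2)] inj B(3) by simp
  moreover have "cspan (f ` B) = f ` N"
    using clin.linear_span_image[OF f] B(3) by simp
  moreover have "card (f ` B) = card B"
    using inj B(3) by (intro card_image) (meson complex_vector.span_superset inj_on_subset)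
  ultimately show ?thesis
    by (metis B(4) complex_vector.dim_span_eq_card_independent)
qed

lemma fin_dim_plus:
  assumes "fin_dim A" and "fin_dim B"
  shows "fin_dim (A + B)"
proof -
  obtain F G where F: "finite F" "A = cspan F" and G: "finite G" "B = cspan G"
    using assms by (auto simp: fin_dim_def)
  have "A + B = cspan (F \<union> G)"
    by (auto simp: F G complex_vector.span_Un set_plus_def)
  then show ?thesis
    using F G by (auto simp: fin_dim_def)
qed

lemma cdim_direct_sum:
  assumes "fin_dim A" and "fin_dim B" and AB: "A \<inter> B \<subseteq> {0}"
  shows "cdim (A + B) = cdim A + cdim B"
proof -
  obtain F where F: "finite F" "complex_vector.independent F" "A = cspan F" "card F = cdim A"
    using fin_dim_basis[OF assms(1)] by metis
  obtain G where G: "finite G" "complex_vector.independent G" "B = cspan G" "card G = cdim B"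
    using fin_dim_basis[OF assms(2)] by metis
  have sub: "F \<subseteq> A" "G \<subseteq> B"
    using F G complex_vector.span_superset by blast+
  have disj: "F \<inter> G = {}"
  proof (rule ccontr)
    assume "F \<inter> G \<noteq> {}"
    then have "0 \<in> F" using sub AB by auto
    then show False using F(2) complex_vector.dependent_zero by blast
  qed
  have "complex_vector.independent (F \<union> G)"
  proof (rule complex_vector.independent_if_scalars_zero)
    show "finite (F \<union> G)" using F G by simp
    fix u x
    assume 0: "(\<Sum>x\<in>F \<union> G. u x *\<^sub>C x) = 0" and x: "x \<in> F \<union> G"
    define s where "s = (\<Sum>x\<in>F. u x *\<^sub>C x)"
    define t where "t = (\<Sum>x\<in>G. u x *\<^sub>C x)"
    have st: "s + t = 0"
      using 0 disj F(1) G(1) by (simp add: sum.union_disjoint s_def t_def)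
    have s: "s \<in> A" and t: "t \<in> B"
      unfolding s_def t_def F(3) G(3)
      by (auto intro!: complex_vector.span_sum complex_vector.span_scale intro: complex_vector.span_base)
    have "s = - t"
      using st by (simp add: eq_neg_iff_add_eq_0)
    then have "s \<in> B"
      using t complex_vector.subspace_neg[OF fin_dim_subspace[OF assms(2)]] by simp
    then have "s = 0" "t = 0"
      using s AB st by auto
    then show "u x = 0"
      using x complex_vector.independentD[OF F(2) F(1) order_refl]
        complex_vector.independentD[OF G(2) G(1) order_refl]
      by (auto simp: s_def t_def)
  qed
  moreover have "A + B = cspan (F \<union> G)"
    by (auto simp: F G complex_vector.span_Un set_plus_def)
  ultimately show ?thesis
    using complex_vector.dim_span_eq_card_independent[of "F \<union> G"]
    by (simp add: card_Un_disjoint[OF F(1) G(1) disj] F(4) G(4))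
qed

definition complementary :: "'a::complex_vector set \<Rightarrow> 'a set \<Rightarrow> bool" where
  "complementary A B \<longleftrightarrow> csubspace A \<and> csubspace B \<and> A \<inter> B \<subseteq> {0} \<and> A + B = UNIV"

lemma complementary_split:
  assumes "complementary A B"
  obtains a b where "a \<in> A" "b \<in> B" "x = a + b"
proof -
  have "x \<in> A + B" using assms by (simp add: complementary_def)
  then show thesis using that by (auto elim!: set_plus_elim)
qed

lemma complementary_0:
  assumes "complementary A B" and "a \<in> A" and "b \<in> B" and "a + b = 0"
  shows "a = 0" and "b = 0"
proof -
  have "a = - b"
    using assms(4) by (simp add: eq_neg_iff_add_eq_0)
  then have "a \<in> B"
    using assms complex_vector.subspace_neg[of B b] by (simp add: complementary_def)
  then show "a = 0" using assms by (auto simp: complementary_def)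
  then show "b = 0" using assms by simp
qed

lemma complementary_exists:
  assumes "csubspace A"
  shows "\<exists>B. complementary A B"
proof -
  obtain F where F: "F \<subseteq> A" "complex_vector.independent F" "A \<subseteq> cspan F"
    by (rule complex_vector.basis_exists[of A])
  obtain G where G: "F \<subseteq> G" "complex_vector.independent G" "UNIV \<subseteq> cspan G"
    by (rule complex_vector.maximal_independent_subset_extend[OF subset_UNIV F(2)])
  have A: "A = cspan F"
    using complex_vector.span_subspace[OF F(1,3) assms] by simp
  have "cspan F \<inter> cspan (G - F) \<subseteq> {0}"
  proof
    fix x assume "x \<in> cspan F \<inter> cspan (G - F)"
    then obtain S u T v where S: "finite S" "S \<subseteq> F" "x = (\<Sum>a\<in>S. u a *\<^sub>C a)"
      and T: "finite T" "T \<subseteq> G - F" "x = (\<Sum>a\<in>T. v a *\<^sub>C a)"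
      unfolding complex_vector.span_explicit by blast
    define w where "w a = (if a \<in> S then u a else - v a)" for a
    have disj: "S \<inter> T = {}" using S T by auto
    have "(\<Sum>a\<in>S \<union> T. w a *\<^sub>C a) = (\<Sum>a\<in>S. w a *\<^sub>C a) + (\<Sum>a\<in>T. w a *\<^sub>C a)"
      using S T disj by (simp add: sum.union_disjoint)
    also have "(\<Sum>a\<in>S. w a *\<^sub>C a) = x"
      by (simp add: S(3) w_def)
    also have "(\<Sum>a\<in>T. w a *\<^sub>C a) = (\<Sum>a\<in>T. - (v a *\<^sub>C a))"
      using disj by (intro sum.cong) (auto simp: w_def complex_vector.scale_minus_left)
    also have "\<dots> = - x"
      by (simp add: T(3) sum_negf)
    finally have "(\<Sum>a\<in>S \<union> T. w a *\<^sub>C a) = 0" by simp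
    then have "w a = 0" if "a \<in> S \<union> T" for a
      using complex_vector.independentD[OF G(2), of "S \<union> T" w a] S T G(1) that by auto
    then have "\<forall>a\<in>S. u a = 0" by (metis UnI1 w_def)
    then show "x \<in> {0}" by (simp add: S(3))
  qed
  moreover have "cspan F + cspan (G - F) = UNIV"
  proof -
    have "cspan F + cspan (G - F) = cspan (F \<union> (G - F))"
      unfolding complex_vector.span_Un set_plus_def by blast
    then show ?thesis using G by (simp add: Un_absorb1 top.extremum_uniqueI)
  qed
  ultimately show ?thesis
    unfolding complementary_def A by (intro exI[of _ "cspan (G - F)"]) auto
qed

lemma complementary_projection:
  assumes AB: "complementary A B"
  obtains p where "clinear p" "\<And>x. p x \<in> B" "\<And>x. x - p x \<in> A" "\<And>b. b \<in> B \<Longrightarrow> p b = b"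
    "\<And>a. a \<in> A \<Longrightarrow> p a = 0"
proof -
  have sA: "csubspace A" and sB: "csubspace B"
    using AB by (auto simp: complementary_def)
  have "\<exists>b. b \<in> B \<and> x - b \<in> A" for x
    using complementary_split[OF AB, of x] by (metis add_diff_cancel_right')
  then obtain p where p: "\<And>x. p x \<in> B" "\<And>x. x - p x \<in> A"
    by metis
  have uniq: "p x = b" if "b \<in> B" "x - b \<in> A" for x b
  proof -
    have "(x - b) - (x - p x) \<in> A" "b - p x \<in> B"
      by (rule complex_vector.subspace_diff[OF sA that(2) p(2)],
          rule complex_vector.subspace_diff[OF sB that(1) p(1)])
    then have "p x - b \<in> A" "- (p x - b) \<in> B" by simp_all
    then show ?thesis
      using complementary_0(1)[OF AB, of "p x - b" "- (p x - b)"] by simp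
  qed
  have "clinear p"
  proof (rule clinearI)
    fix x y
    have "x + y - (p x + p y) = (x - p x) + (y - p y)" by simp
    then show "p (x + y) = p x + p y"
      using uniq[of "p x + p y" "x + y"] complex_vector.subspace_add[OF sA p(2) p(2)]
        complex_vector.subspace_add[OF sB p(1) p(1)] by metis
  next
    fix c x
    have "c *\<^sub>C x - c *\<^sub>C p x = c *\<^sub>C (x - p x)"
      by (simp add: complex_vector.scale_right_diff_distrib)
    then show "p (c *\<^sub>C x) = c *\<^sub>C p x"
      using uniq[of "c *\<^sub>C p x" "c *\<^sub>C x"] complex_vector.subspace_scale[OF sA p(2)]
        complex_vector.subspace_scale[OF sB p(1)] by metis
  qed
  moreover have "p b = b" if "b \<in> B" for b
    using that complex_vector.subspace_0[OF sA] by (intro uniq) auto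
  moreover have "p a = 0" if "a \<in> A" for a
    using that complex_vector.subspace_0[OF sB] by (intro uniq) auto
  ultimately show thesis using that p by blast
qed

text \<open>The projection onto one complement along the common subspace maps the other complement
  isomorphically: all complements of a subspace are copies of the quotient by it.\<close>

lemma complementary_unique_dim:
  assumes C: "complementary W C" and C': "complementary W C'" and fin: "fin_dim C"
  shows "fin_dim C'" and "cdim C' = cdim C"
proof -
  obtain p where p: "clinear p" "\<And>x. p x \<in> C'" "\<And>x. x - p x \<in> W"
    "\<And>b. b \<in> C' \<Longrightarrow> p b = b" "\<And>a. a \<in> W \<Longrightarrow> p a = 0"
    using complementary_projection[OF C'] by metis
  have inj: "inj_on p C"
  proof (rule inj_onI)
    fix x y assume xy: "x \<in> C" "y \<in> C" "p x = p y"
    have "(x - p x) - (y - p y) \<in> W"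
      using complex_vector.subspace_diff[OF _ p(3) p(3)] C by (simp add: complementary_def)
    then have "x - y \<in> W" using xy by simp
    moreover have "x - y \<in> C"
      using xy C by (intro complex_vector.subspace_diff) (auto simp: complementary_def)
    ultimately show "x = y" using C by (auto simp: complementary_def)
  qed
  have img: "p ` C = C'"
  proof
    show "p ` C \<subseteq> C'" using p by auto
    show "C' \<subseteq> p ` C"
    proof
      fix y assume y: "y \<in> C'"
      obtain w c where wc: "w \<in> W" "c \<in> C" "y = w + c"
        using complementary_split[OF C] by metis
      then have "p y = p c" using p(5) clin.linear_add[OF p(1)] by simp
      then show "y \<in> p ` C" using p(4)[OF y] wc(2) by (metis imageI)
    qed
  qed
  show "fin_dim C'" using fin_dim_image[OF p(1) fin] img by simp
  show "cdim C' = cdim C" using cdim_inj_image[OF p(1) fin inj] img by simp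
qed

lemma complementary_assoc:
  assumes "complementary (A + B) C" and "csubspace A" and "csubspace B" and "A \<inter> B \<subseteq> {0}"
  shows "complementary A (B + C)" and "B \<inter> C \<subseteq> {0}"
proof -
  have sC: "csubspace C" using assms by (simp add: complementary_def)
  have B: "B \<subseteq> A + B"
    using complex_vector.subspace_0[OF assms(2)] set_plus_intro[of 0 A] by fastforce
  then show "B \<inter> C \<subseteq> {0}"
    using assms(1) by (auto simp: complementary_def)
  have "A \<inter> (B + C) \<subseteq> {0}"
  proof
    fix x assume "x \<in> A \<inter> (B + C)"
    then obtain b c where x: "x \<in> A" "x = b + c" "b \<in> B" "c \<in> C"
      by (auto simp: set_plus_def)
    have "x + (- b) \<in> A + B"
      using x complex_vector.subspace_neg[OF assms(3)] by (intro set_plus_intro) auto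
    then have "c \<in> A + B" using x by simp
    then have "c = 0" using x assms(1) by (auto simp: complementary_def)
    then show "x \<in> {0}" using x assms(4) by auto
  qed
  then show "complementary A (B + C)"
    using assms sC csubspace_plus[OF assms(3) sC] by (simp add: complementary_def add.assoc)
qed

section \<open>Codimension and index in terms of complements\<close>

lemma coset_eq_iff:
  assumes "csubspace W"
  shows "{x} + W = {y} + W \<longleftrightarrow> x - y \<in> W"
proof
  assume "{x} + W = {y} + W"
  moreover have "x \<in> {x} + W"
    using set_plus_intro[of x "{x}" 0 W] complex_vector.subspace_0[OF assms] by simp
  ultimately show "x - y \<in> W" by (auto simp: set_plus_def)
next
  have "{x} + W \<subseteq> {y} + W" if "x - y \<in> W" for x y
  proof
    fix z assume "z \<in> {x} + W"
    then obtain w where w: "w \<in> W" "z = x + w" by (auto simp: set_plus_def)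
    then have "z = y + ((x - y) + w)" by simp
    then show "z \<in> {y} + W"
      using complex_vector.subspace_add[OF assms that w(1)] by (metis set_plus_intro singletonI)
  qed
  moreover assume "x - y \<in> W"
  moreover have "y - x \<in> W"
    using complex_vector.subspace_neg[OF assms \<open>x - y \<in> W\<close>] by simp
  ultimately show "{x} + W = {y} + W" by blast
qed

text \<open>The quotient map restricts to an isomorphism of a complement onto the quotient, so bases of
  the one correspond to bases of the other.  The next two lemmas carry a basis across in both
  directions; together with the equality of dimensions of complements they show that the arbitrary
  choice in \<^const>\<open>codim\<close> does not influence its value.\<close>

lemma quotient_basis_of_complement:
  assumes WC: "complementary W C" and fin: "fin_dim C"
  shows "\<exists>Q. quotient_basis W Q"
proof -
  obtain B where B: "finite B" "complex_vector.independent B" "C = cspan B"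
    using fin_dim_basis[OF fin] by metis
  have W: "csubspace W" and C: "csubspace C" and WC0: "W \<inter> C \<subseteq> {0}"
    using WC by (auto simp: complementary_def)
  have BC: "B \<subseteq> C" using B(3) complex_vector.span_superset by simp
  let ?c = "\<lambda>b. {b} + W"
  have inj: "inj_on ?c B"
  proof (rule inj_onI)
    fix a b assume ab: "a \<in> B" "b \<in> B" "?c a = ?c b"
    then have "a - b \<in> W" "a - b \<in> C"
      using coset_eq_iff[OF W] BC by (auto intro: complex_vector.subspace_diff[OF C])
    then show "a = b" using WC0 by auto
  qed
  have comb: "quotient_comb W u (?c ` B) = {\<Sum>b\<in>B. u (?c b) *\<^sub>C b} + W" for u
    by (rule quotient_comb_cosets[OF W B(1) inj])
  have "quotient_basis W (?c ` B)"
    unfolding quotient_basis_def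
  proof (intro conjI ballI)
    show "finite (?c ` B)" using B by simp
    show "?c ` B \<subseteq> quotient_space W" by (auto simp: quotient_space_def)
    fix p assume "p \<in> quotient_space W"
    then obtain y where y: "p = {y} + W" by (auto simp: quotient_space_def)
    obtain w c where wc: "w \<in> W" "c \<in> C" "y = w + c"
      using complementary_split[OF WC] by metis
    obtain r where r: "c = (\<Sum>b\<in>B. r b *\<^sub>C b)"
      using wc(2) by (auto simp: B(3) complex_vector.span_finite[OF B(1)])
    define u where "u q = (if q \<in> ?c ` B then r (the_inv_into B ?c q) else 0)" for q
    have u: "u (?c b) = r b" if "b \<in> B" for b
      using that by (simp add: u_def the_inv_into_f_f[OF inj])
    show "\<exists>!u. (\<forall>q. q \<notin> ?c ` B \<longrightarrow> u q = 0) \<and> quotient_comb W u (?c ` B) = p"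
    proof (rule ex1I[of _ u], intro conjI allI impI)
      fix q assume "q \<notin> ?c ` B" then show "u q = 0" by (simp add: u_def)
    next
      have "(\<Sum>b\<in>B. u (?c b) *\<^sub>C b) = c" using u by (simp add: r)
      moreover have "{c} + W = {y} + W"
        using coset_eq_iff[OF W, of y c] wc by simp
      ultimately show "quotient_comb W u (?c ` B) = p" by (simp add: comb y)
    next
      fix v assume v: "(\<forall>q. q \<notin> ?c ` B \<longrightarrow> v q = 0) \<and> quotient_comb W v (?c ` B) = p"
      let ?d = "\<Sum>b\<in>B. v (?c b) *\<^sub>C b"
      have "{?d} + W = {c} + W"
        using v coset_eq_iff[OF W, of y c] wc by (simp add: comb y)
      then have "?d - c \<in> W" using coset_eq_iff[OF W] by simp
      moreover have "?d \<in> C"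
        unfolding B(3)
        by (auto intro!: complex_vector.span_sum complex_vector.span_scale intro: complex_vector.span_base)
      ultimately have "?d - c = 0"
        using complex_vector.subspace_diff[OF C, of ?d c] wc WC0 by auto
      moreover have "?d - c = (\<Sum>b\<in>B. (v (?c b) - r b) *\<^sub>C b)"
        by (simp add: r complex_vector.scale_left_diff_distrib sum_subtractf)
      ultimately have "(\<Sum>b\<in>B. (v (?c b) - r b) *\<^sub>C b) = 0" by simp
      then have "v (?c b) = r b" if "b \<in> B" for b
        using complex_vector.independentD[OF B(2,1) order_refl, of "\<lambda>b. v (?c b) - r b"] that
        by simp
      then have "v q = u q" for q
      proof (cases "q \<in> ?c ` B")
        case False
        then show ?thesis using v by (simp add: u_def)
      qed (use u in auto)
      then show "v = u" by blast
    qed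
  qed
  then show ?thesis by blast
qed

lemma complement_of_quotient_basis:
  assumes W: "csubspace W" and Q: "quotient_basis W Q"
  shows "\<exists>C. complementary W C \<and> fin_dim C \<and> cdim C = card Q"
proof -
  have "\<exists>y. q = {y} + W" if "q \<in> Q" for q
    using Q that by (auto simp: quotient_basis_def quotient_space_def)
  then obtain y where y: "\<And>q. q \<in> Q \<Longrightarrow> {y q} + W = q" by metis
  have fin: "finite Q" using Q by (simp add: quotient_basis_def)
  have img: "(\<lambda>q. {y q} + W) ` Q = Q" using y by force
  have injc: "inj_on (\<lambda>q. {y q} + W) Q" using y by (simp add: inj_on_def)
  have inj: "inj_on y Q" using y by (metis inj_onI)
  have comb: "quotient_comb W u Q = {\<Sum>q\<in>Q. u q *\<^sub>C y q} + W" for u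
    using quotient_comb_cosets[OF W fin injc, of u] y by (simp add: img)
  have zero: "u q = 0" if u: "(\<Sum>q\<in>Q. u q *\<^sub>C y q) \<in> W" and q: "q \<in> Q" for u q
  proof -
    define v where "v q = (if q \<in> Q then u q else 0)" for q
    have "quotient_comb W v Q = {\<Sum>q\<in>Q. u q *\<^sub>C y q} + W"
      by (simp add: comb v_def)
    also have "\<dots> = {0} + W"
      using u coset_eq_iff[OF W, of "\<Sum>q\<in>Q. u q *\<^sub>C y q" 0] by simp
    finally have "quotient_comb W v Q = {0} + W" .
    then have v: "(\<forall>q. q \<notin> Q \<longrightarrow> v q = 0) \<and> quotient_comb W v Q = {0} + W"
      by (simp add: v_def)
    have 0: "(\<forall>q. q \<notin> Q \<longrightarrow> (\<lambda>_. 0 :: complex) q = 0) \<and> quotient_comb W (\<lambda>_. 0) Q = {0} + W"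
      by (simp add: comb)
    have "{0} + W \<in> quotient_space W"
      unfolding quotient_space_def by (rule rangeI)
    then have "\<exists>!u. (\<forall>q. q \<notin> Q \<longrightarrow> u q = 0) \<and> quotient_comb W u Q = {0} + W"
      using Q unfolding quotient_basis_def by blast
    then have "\<exists>\<^sub>\<le>\<^sub>1u. (\<forall>q. q \<notin> Q \<longrightarrow> u q = 0) \<and> quotient_comb W u Q = {0} + W"
      by (simp add: ex1_iff_ex_Uniq)
    then have "v = (\<lambda>_. 0)"
      by (rule Uniq_D) (rule v, rule 0)
    then have "v q = 0" by simp
    then show ?thesis using q by (simp add: v_def)
  qed
  have span: "cspan (y ` Q) = range (\<lambda>u. \<Sum>q\<in>Q. u (y q) *\<^sub>C y q)"
    using fin by (simp add: complex_vector.span_finite sum.reindex[OF inj])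
  have "W \<inter> cspan (y ` Q) \<subseteq> {0}"
  proof
    fix x assume x: "x \<in> W \<inter> cspan (y ` Q)"
    then obtain u where u: "x = (\<Sum>q\<in>Q. u (y q) *\<^sub>C y q)"
      using span by auto
    have "u (y q) = 0" if "q \<in> Q" for q
      using zero[of "\<lambda>q. u (y q)" q] x u that by simp
    then show "x \<in> {0}" by (simp add: u)
  qed
  moreover have "W + cspan (y ` Q) = UNIV"
  proof (intro equalityI subset_UNIV subsetI)
    fix x
    have "{x} + W \<in> quotient_space W" by (auto simp: quotient_space_def)
    then obtain u where "quotient_comb W u Q = {x} + W"
      using Q unfolding quotient_basis_def by blast
    then have "{x} + W = {\<Sum>q\<in>Q. u q *\<^sub>C y q} + W"
      by (simp add: comb)
    then have "x - (\<Sum>q\<in>Q. u q *\<^sub>C y q) \<in> W"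
      using coset_eq_iff[OF W] by simp
    moreover have "(\<Sum>q\<in>Q. u q *\<^sub>C y q) \<in> cspan (y ` Q)"
      by (auto intro!: complex_vector.span_sum complex_vector.span_scale intro: complex_vector.span_base)
    ultimately show "x \<in> W + cspan (y ` Q)"
      using set_plus_intro by fastforce
  qed
  ultimately have "complementary W (cspan (y ` Q))"
    using W by (simp add: complementary_def)
  moreover have "complex_vector.independent (y ` Q)"
  proof (rule complex_vector.independent_if_scalars_zero)
    show "finite (y ` Q)" using fin by simp
    fix u x assume "(\<Sum>x\<in>y ` Q. u x *\<^sub>C x) = 0" "x \<in> y ` Q"
    then show "u x = 0"
      using zero[of "\<lambda>q. u (y q)"] complex_vector.subspace_0[OF W] by (auto simp: sum.reindex[OF inj])
  qed
  then have "cdim (cspan (y ` Q)) = card Q"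
    using complex_vector.dim_span_eq_card_independent[of "y ` Q"] card_image[OF inj] by simp
  moreover have "fin_dim (cspan (y ` Q))"
    unfolding fin_dim_def using fin by blast
  ultimately show ?thesis by blast
qed

lemma finite_codim_iff_complement:
  assumes "csubspace W"
  shows "finite_codim W \<longleftrightarrow> (\<exists>C. complementary W C \<and> fin_dim C)"
  using assms quotient_basis_of_complement complement_of_quotient_basis
  unfolding finite_codim_def by blast

lemma codim_eq_cdim_complement:
  assumes "complementary W C" and "fin_dim C"
  shows "codim W = cdim C"
proof -
  have W: "csubspace W" using assms by (simp add: complementary_def)
  have "quotient_basis W (SOME Q. quotient_basis W Q)"
    using quotient_basis_of_complement[OF assms] by (rule someI_ex)
  from complement_of_quotient_basis[OF W this] obtain C' where
    "complementary W C'" "cdim C' = codim W"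
    by (auto simp: codim_def)
  then show ?thesis using complementary_unique_dim(2)[OF assms(1) _ assms(2)] by metis
qed

lemma clinear_bounded_ops: "T \<in> bounded_ops \<Longrightarrow> clinear (blinfun_apply T)"
  by (intro clinearI) (auto simp: bounded_ops_def blinfun.add_right)

lemma csubspace_ker: "T \<in> bounded_ops \<Longrightarrow> csubspace (ker T)"
  unfolding ker_def by (rule clin.linear_subspace_kernel[OF clinear_bounded_ops])

lemma csubspace_image: "T \<in> bounded_ops \<Longrightarrow> csubspace S \<Longrightarrow> csubspace (blinfun_apply T ` S)"
  by (rule clin.linear_subspace_image[OF clinear_bounded_ops])

text \<open>The purely algebraic content of the Fredholm property.  It already determines the index, and
  it can be verified for an operator from its products with others.\<close>

definition finite_defects :: "('a::complex_normed_vector \<Rightarrow>\<^sub>L 'b::complex_normed_vector) \<Rightarrow> bool" where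
  "finite_defects T \<longleftrightarrow> T \<in> bounded_ops \<and> fin_dim (ker T) \<and>
     (\<exists>C. complementary (range (blinfun_apply T)) C \<and> fin_dim C)"

lemma Fredholm_finite_defects: "Fredholm T \<Longrightarrow> finite_defects T"
  using finite_codim_iff_complement[OF csubspace_image[OF _ complex_vector.subspace_UNIV], of T]
  unfolding Fredholm_def finite_defects_def fin_dim_def by blast

lemma ind_eq_complement:
  assumes "complementary (range (blinfun_apply T)) C" and "fin_dim C"
  shows "ind T = int (cdim (ker T)) - int (cdim C)"
  using codim_eq_cdim_complement[OF assms] by (simp add: ind_def)

text \<open>The index can be read off from any subspace of finite codimension that is mapped injectively
  onto a subspace of finite codimension: enlarging it to a complement of the kernel adds the same
  number of dimensions to the subspace and to its image.  This is what makes the index robust, since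
  \<open>L\<close>, \<open>N\<close> and \<open>C\<close> survive perturbations that change the kernel and the
  range.\<close>

lemma ind_by_restriction:
  assumes T: "T \<in> bounded_ops"
    and LN: "complementary L N" and N: "fin_dim N"
    and RC: "complementary (blinfun_apply T ` L) C" and C: "fin_dim C"
    and inj: "\<And>x. x \<in> L \<Longrightarrow> blinfun_apply T x = 0 \<Longrightarrow> x = 0"
  shows "finite_defects T" and "ind T = int (cdim N) - int (cdim C)"
proof -
  note lin = clinear_bounded_ops[OF T]
  let ?K = "ker T"
  have K: "csubspace ?K" using T by (rule csubspace_ker)
  have L: "csubspace L" using LN by (simp add: complementary_def)
  have LK: "L \<inter> ?K \<subseteq> {0}" using inj by (auto simp: ker_def)
  obtain E where E: "complementary (L + ?K) E"
    using complementary_exists[OF csubspace_plus[OF L K]] by blast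
  have sE: "csubspace E" using E by (simp add: complementary_def)
  note LKE = complementary_assoc[OF E L K LK]
  have KE: "fin_dim (?K + E)" "cdim (?K + E) = cdim N"
    using complementary_unique_dim[OF LN LKE(1) N] by auto
  have 0: "0 \<in> L" "0 \<in> ?K" "0 \<in> E"
    using L K sE by (simp_all add: complex_vector.subspace_0)
  have finK: "fin_dim ?K" and finE: "fin_dim E"
    using fin_dim_subset[OF KE(1) K] fin_dim_subset[OF KE(1) sE]
      set_zero_plus2[OF 0(3), of ?K] set_zero_plus2[OF 0(2), of E] by (auto simp: add.commute)
  have dimN: "cdim N = cdim ?K + cdim E"
    using cdim_direct_sum[OF finK finE LKE(2)] KE(2) by simp
  have TLE: "x = 0" if "x \<in> E" "l \<in> L" "blinfun_apply T x = blinfun_apply T l" for x l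
  proof -
    have "x - l \<in> ?K" using that by (simp add: ker_def blinfun.diff_right)
    then have "x \<in> L + ?K" using that(2) set_plus_intro[of l L "x - l" ?K] by simp
    then show ?thesis using that(1) E by (auto simp: complementary_def)
  qed
  have injE: "inj_on (blinfun_apply T) E"
  proof (rule inj_onI)
    fix x y assume xy: "x \<in> E" "y \<in> E" "blinfun_apply T x = blinfun_apply T y"
    then have "x - y \<in> E" "blinfun_apply T (x - y) = blinfun_apply T 0"
      by (auto simp: blinfun.diff_right intro: complex_vector.subspace_diff[OF sE])
    then show "x = y" using TLE 0 by fastforce
  qed
  have range_eq: "range (blinfun_apply T) = blinfun_apply T ` L + blinfun_apply T ` E"
  proof (intro equalityI subsetI)
    fix y assume "y \<in> range (blinfun_apply T)"
    then obtain x where x: "y = blinfun_apply T x" by auto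
    obtain l z where l: "l \<in> L" "z \<in> ?K + E" "x = l + z"
      using complementary_split[OF LKE(1)] by metis
    then obtain k e where k: "k \<in> ?K" "e \<in> E" "z = k + e" by (auto elim: set_plus_elim)
    have "y = blinfun_apply T l + blinfun_apply T e"
      using x l k by (simp add: blinfun.add_right ker_def)
    then show "y \<in> blinfun_apply T ` L + blinfun_apply T ` E"
      using l k by auto
  next
    fix y assume "y \<in> blinfun_apply T ` L + blinfun_apply T ` E"
    then obtain l e where "y = blinfun_apply T l + blinfun_apply T e"
      by (auto elim!: set_plus_elim)
    then show "y \<in> range (blinfun_apply T)"
      by (metis blinfun.add_right rangeI)
  qed
  have meet: "blinfun_apply T ` L \<inter> blinfun_apply T ` E \<subseteq> {0}"
  proof
    fix y assume "y \<in> blinfun_apply T ` L \<inter> blinfun_apply T ` E"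
    then obtain l e where "l \<in> L" "e \<in> E" "y = blinfun_apply T e" "y = blinfun_apply T l"
      by blast
    then show "y \<in> {0}" using TLE[of e l] by (simp add: blinfun.zero_right)
  qed
  obtain D where D: "complementary (range (blinfun_apply T)) D"
    using complementary_exists[OF csubspace_image[OF T complex_vector.subspace_UNIV]] by blast
  note TED = complementary_assoc[OF D[unfolded range_eq] csubspace_image[OF T L]
      csubspace_image[OF T sE] meet]
  have ED: "fin_dim (blinfun_apply T ` E + D)" "cdim (blinfun_apply T ` E + D) = cdim C"
    using complementary_unique_dim[OF RC TED(1) C] by auto
  have sD: "csubspace D" using D by (simp add: complementary_def)
  have "0 \<in> blinfun_apply T ` E"
    using 0 by (metis blinfun.zero_right imageI)
  then have finD: "fin_dim D"
    using fin_dim_subset[OF ED(1) sD set_zero_plus2] by blast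
  have "cdim C = cdim (blinfun_apply T ` E) + cdim D"
    using cdim_direct_sum[OF fin_dim_image[OF lin finE] finD TED(2)] ED(2) by simp
  also have "cdim (blinfun_apply T ` E) = cdim E"
    by (rule cdim_inj_image[OF lin finE injE])
  finally show "ind T = int (cdim N) - int (cdim C)"
    using dimN ind_eq_complement[OF D finD] by simp
  show "finite_defects T"
    unfolding finite_defects_def using T finK D finD by blast
qed

text \<open>For \<open>I - ab\<close> and \<open>I - ba\<close> the operator \<open>b\<close> maps kernel to kernel and complement of
  the range to complement of the range, in both cases bijectively.\<close>

lemma ind_swap:
  assumes a: "a \<in> bounded_ops" and b: "b \<in> bounded_ops"
    and fin: "finite_defects (id_blinfun - (a o\<^sub>L b))"
  shows "ind (id_blinfun - (a o\<^sub>L b)) = ind (id_blinfun - (b o\<^sub>L a))"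
proof -
  let ?S = "id_blinfun - (a o\<^sub>L b)" and ?T = "id_blinfun - (b o\<^sub>L a)"
  note lin = clinear_bounded_ops[OF b]
  have S: "blinfun_apply ?S x = x - blinfun_apply a (blinfun_apply b x)" for x
    by (simp add: blinfun.diff_left)
  have T: "blinfun_apply ?T x = x - blinfun_apply b (blinfun_apply a x)" for x
    by (simp add: blinfun.diff_left)
  have Tb: "?T \<in> bounded_ops"
    using a b by (auto simp: bounded_ops_def T complex_vector.scale_right_diff_distrib)
  have ker: "ker ?T = blinfun_apply b ` ker ?S"
  proof (intro equalityI subsetI)
    fix y assume "y \<in> ker ?T"
    then have y: "y = blinfun_apply b (blinfun_apply a y)" by (simp add: ker_def T)
    then have "blinfun_apply a y \<in> ker ?S" by (simp add: ker_def S)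
    then show "y \<in> blinfun_apply b ` ker ?S" using y by (metis imageI)
  next
    fix y assume "y \<in> blinfun_apply b ` ker ?S"
    then obtain x where x: "y = blinfun_apply b x" "x = blinfun_apply a (blinfun_apply b x)"
      by (auto simp: ker_def S)
    then show "y \<in> ker ?T" by (metis (mono_tags) T cancel_comm_monoid_add_class.diff_cancel ker_def mem_Collect_eq)
  qed
  have injk: "inj_on (blinfun_apply b) (ker ?S)"
    by (rule inj_onI) (metis (mono_tags) S eq_iff_diff_eq_0 ker_def mem_Collect_eq)
  have fink: "fin_dim (ker ?S)" using fin by (simp add: finite_defects_def)
  obtain C where C: "complementary (range (blinfun_apply ?S)) C" "fin_dim C"
    using fin by (auto simp: finite_defects_def)
  have sC: "csubspace C" using C by (simp add: complementary_def)
  have meet: "c = 0" if "c \<in> C" "blinfun_apply b c \<in> range (blinfun_apply ?T)" for c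
  proof -
    note bc = that(2)
    obtain z where z: "blinfun_apply b c = z - blinfun_apply b (blinfun_apply a z)"
      using bc T by (metis imageE)
    have "blinfun_apply ?S (c + blinfun_apply a z) = c + blinfun_apply a (z - blinfun_apply b (blinfun_apply a z)) - blinfun_apply a (blinfun_apply b c)"
      by (simp add: S blinfun.add_right blinfun.diff_right)
    then have "blinfun_apply ?S (c + blinfun_apply a z) = c" by (simp add: z)
    then have "c \<in> range (blinfun_apply ?S)" by (metis rangeI)
    then show ?thesis using that C by (auto simp: complementary_def)
  qed
  have "complementary (range (blinfun_apply ?T)) (blinfun_apply b ` C)"
    unfolding complementary_def
  proof (intro conjI)
    show "csubspace (range (blinfun_apply ?T))"
      by (rule csubspace_image[OF Tb complex_vector.subspace_UNIV])
    show "csubspace (blinfun_apply b ` C)"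
      by (rule csubspace_image[OF b sC])
    show "range (blinfun_apply ?T) \<inter> blinfun_apply b ` C \<subseteq> {0}"
    proof
      fix y assume "y \<in> range (blinfun_apply ?T) \<inter> blinfun_apply b ` C"
      then have y: "y \<in> range (blinfun_apply ?T)" and "y \<in> blinfun_apply b ` C" by (rule IntD1, rule IntD2)
      then obtain c where c: "y = blinfun_apply b c" "c \<in> C" by (auto elim: imageE)
      then have "c = 0" using meet[OF c(2)] y by simp
      then show "y \<in> {0}" using c(1) by (simp add: blinfun.zero_right)
    qed
    show "range (blinfun_apply ?T) + blinfun_apply b ` C = UNIV"
    proof (intro equalityI subset_UNIV subsetI)
      fix y
      obtain s c where s: "s \<in> range (blinfun_apply ?S)" "c \<in> C" "blinfun_apply a y = s + c"
        using complementary_split[OF C(1)] by metis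
      then obtain x where x: "blinfun_apply a y = blinfun_apply ?S x + c" by auto
      have "y = blinfun_apply ?T y + blinfun_apply b (blinfun_apply a y)"
        by (simp add: T)
      also have "\<dots> = blinfun_apply ?T (y + blinfun_apply b x) + blinfun_apply b c"
        by (simp add: x S T blinfun.add_right blinfun.diff_right)
      finally show "y \<in> range (blinfun_apply ?T) + blinfun_apply b ` C"
        using s(2) by (metis imageI rangeI set_plus_intro)
    qed
  qed
  moreover have "fin_dim (blinfun_apply b ` C)"
    using fin_dim_image[OF lin C(2)] .
  ultimately have "ind ?T = int (cdim (ker ?T)) - int (cdim (blinfun_apply b ` C))"
    by (rule ind_eq_complement)
  also have "cdim (ker ?T) = cdim (ker ?S)"
    using cdim_inj_image[OF lin fink injk] ker by simp
  also have "cdim (blinfun_apply b ` C) = cdim C"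
  proof (rule cdim_inj_image[OF lin C(2)], rule inj_onI)
    fix x y assume xy: "x \<in> C" "y \<in> C" "blinfun_apply b x = blinfun_apply b y"
    then have "blinfun_apply b (x - y) = blinfun_apply ?T 0"
      by (simp add: blinfun.diff_right blinfun.zero_right)
    then have "x - y = 0"
      using meet[of "x - y"] complex_vector.subspace_diff[OF sC xy(1,2)] by (metis rangeI)
    then show "x = y" by simp
  qed
  finally show ?thesis
    using ind_eq_complement[OF C] by simp
qed

section \<open>The Hahn-Banach theorem and projections onto finite-dimensional subspaces\<close>

definition sublinear :: "('a::real_vector \<Rightarrow> real) \<Rightarrow> bool" where
  "sublinear p \<longleftrightarrow> (\<forall>x y. p (x + y) \<le> p x + p y) \<and> (\<forall>t x. t > 0 \<longrightarrow> p (t *\<^sub>R x) \<le> t * p x)"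

lemma sublinear_add: "sublinear p \<Longrightarrow> p (x + y) \<le> p x + p y"
  by (simp add: sublinear_def)

lemma sublinear_scale:
  assumes "sublinear p" and "t > 0"
  shows "p (t *\<^sub>R x) = t * p x"
proof (rule antisym)
  show "p (t *\<^sub>R x) \<le> t * p x" using assms by (simp add: sublinear_def)
  have "p ((1 / t) *\<^sub>R (t *\<^sub>R x)) \<le> (1 / t) * p (t *\<^sub>R x)"
    using assms unfolding sublinear_def by (metis zero_less_divide_1_iff)
  then show "t * p x \<le> p (t *\<^sub>R x)" using assms by (simp add: field_simps)
qed

lemma sublinear_0: "sublinear p \<Longrightarrow> p 0 = 0"
  using sublinear_scale[of p 2 0] by simp

lemma sublinear_lower: "sublinear p \<Longrightarrow> - p (- x) \<le> p x"
  using sublinear_add[of p x "- x"] sublinear_0[of p] by simp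

text \<open>Along the ray through \<open>y\<close> a sublinear functional is decreased until it is linear there.  A
  minimal sublinear functional therefore equals all its modifications and is linear.\<close>

definition linearized :: "('a::real_vector \<Rightarrow> real) \<Rightarrow> 'a \<Rightarrow> 'a \<Rightarrow> real" where
  "linearized p y x = (INF t\<in>{0..}. p (x + t *\<^sub>R y) - t * p y)"

lemma linearized_le:
  assumes "sublinear p" and "t \<ge> 0"
  shows "linearized p y x \<le> p (x + t *\<^sub>R y) - t * p y"
proof -
  have "- p (- x) \<le> p (x + t *\<^sub>R y) - t * p y" if "t \<ge> 0" for t
  proof -
    have "p (t *\<^sub>R y) = t * p y"
      using sublinear_scale[OF assms(1)] sublinear_0[OF assms(1)] that by (cases "t = 0") auto
    then show ?thesis using sublinear_add[OF assms(1), of "x + t *\<^sub>R y" "- x"] by simp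
  qed
  then have "bdd_below ((\<lambda>t. p (x + t *\<^sub>R y) - t * p y) ` {0..})"
    by (intro bdd_belowI2[of _ "- p (- x)"]) auto
  then show ?thesis unfolding linearized_def using assms(2) by (auto intro: cINF_lower)
qed

lemma linearized_ge:
  assumes "\<And>t. t \<ge> 0 \<Longrightarrow> c \<le> p (x + t *\<^sub>R y) - t * p y"
  shows "c \<le> linearized p y x"
  unfolding linearized_def using assms by (auto intro!: cINF_greatest)

lemma sublinear_linearized:
  assumes p: "sublinear p"
  shows "sublinear (linearized p y)"
  unfolding sublinear_def
proof (intro conjI allI impI)
  fix a b
  have le: "linearized p y (a + b) - (p (a + t *\<^sub>R y) - t * p y) \<le> p (b + s *\<^sub>R y) - s * p y"
    if "t \<ge> 0" "s \<ge> 0" for t s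
  proof -
    have "linearized p y (a + b) \<le> p (a + b + (t + s) *\<^sub>R y) - (t + s) * p y"
      using that by (intro linearized_le[OF p]) simp
    also have "p (a + b + (t + s) *\<^sub>R y) \<le> p (a + t *\<^sub>R y) + p (b + s *\<^sub>R y)"
      using sublinear_add[OF p, of "a + t *\<^sub>R y" "b + s *\<^sub>R y"] by (simp add: algebra_simps)
    finally show ?thesis by (simp add: algebra_simps)
  qed
  then have "linearized p y (a + b) - linearized p y b \<le> p (a + t *\<^sub>R y) - t * p y"
    if "t \<ge> 0" for t
    using linearized_ge[of "linearized p y (a + b) - (p (a + t *\<^sub>R y) - t * p y)" p b y, OF le[OF that]]
    by simp
  then show "linearized p y (a + b) \<le> linearized p y a + linearized p y b"
    using linearized_ge[of "linearized p y (a + b) - linearized p y b" p a y] by simp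
next
  fix r :: real and x assume r: "r > 0"
  have "linearized p y (r *\<^sub>R x) / r \<le> p (x + t *\<^sub>R y) - t * p y" if "t \<ge> 0" for t
  proof -
    have "linearized p y (r *\<^sub>R x) \<le> p (r *\<^sub>R x + (r * t) *\<^sub>R y) - (r * t) * p y"
      using that r by (intro linearized_le[OF p]) simp
    also have "r *\<^sub>R x + (r * t) *\<^sub>R y = r *\<^sub>R (x + t *\<^sub>R y)"
      by (simp add: algebra_simps)
    also have "p (r *\<^sub>R (x + t *\<^sub>R y)) = r * p (x + t *\<^sub>R y)"
      by (rule sublinear_scale[OF p r])
    finally show ?thesis using r by (simp add: field_simps)
  qed
  from linearized_ge[OF this] show "linearized p y (r *\<^sub>R x) \<le> r * linearized p y x"
    using r by (simp add: field_simps)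
qed

text \<open>Zorn's lemma applies because a chain of sublinear functionals below \<open>p\<close> is bounded
  below pointwise by \<open>- p (- x)\<close>, and its pointwise infimum is again sublinear.\<close>

lemma minimal_sublinear_exists:
  assumes p: "sublinear p"
  obtains g where "sublinear g" "g \<le> p" "\<And>q. sublinear q \<Longrightarrow> q \<le> g \<Longrightarrow> q = g"
proof -
  define A where "A = {q. sublinear q \<and> q \<le> p}"
  have "\<exists>m\<in>A. \<forall>a\<in>A. a \<le> m \<longrightarrow> a = m"
  proof (rule predicate_Zorn[where P = "\<lambda>q r. r \<le> q"])
    show "partial_order_on A (relation_of (\<lambda>q r. r \<le> q) A)"
      by (auto simp: partial_order_on_def preorder_on_def refl_on_def trans_def antisym_def
          relation_of_def)
    fix C assume C: "C \<in> Chains (relation_of (\<lambda>q r. r \<le> q) A)"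
    show "\<exists>u\<in>A. \<forall>a\<in>C. u \<le> a"
    proof (cases "C = {}")
      case True
      then show ?thesis using p by (auto simp: A_def)
    next
      case False
      have CA: "sublinear q" "q \<le> p" if "q \<in> C" for q
        using C that by (auto simp: Chains_def relation_of_def A_def)
      have cmp: "q \<le> r \<or> r \<le> q" if "q \<in> C" "r \<in> C" for q r
        using C that by (auto simp: Chains_def relation_of_def)
      define u where "u x = (INF q\<in>C. q x)" for x
      have "- p (- x) \<le> q x" if "q \<in> C" for q x
        using sublinear_lower[OF CA(1)[OF that], of x] CA(2)[OF that] by (auto simp: le_fun_def intro: order_trans[rotated])
      then have "bdd_below ((\<lambda>q. q x) ` C)" for x
        by (intro bdd_belowI2[of _ "- p (- x)"]) auto
      then have lower: "u x \<le> q x" if "q \<in> C" for q x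
        unfolding u_def using that by (rule cINF_lower)
      have ge: "c \<le> u x" if "\<And>q. q \<in> C \<Longrightarrow> c \<le> q x" for c x
        unfolding u_def using False that by (rule cINF_greatest)
      have "sublinear u"
        unfolding sublinear_def
      proof (intro conjI allI impI)
        fix x y
        have le: "u (x + y) - q x \<le> r y" if qr: "q \<in> C" "r \<in> C" for q r
        proof -
          obtain s where s: "s \<in> C" "s \<le> q" "s \<le> r" using cmp[OF qr] qr by blast
          have "u (x + y) \<le> s x + s y"
            using lower[OF s(1), of "x + y"] sublinear_add[OF CA(1)[OF s(1)], of x y] by simp
          also have "\<dots> \<le> q x + r y" using s by (intro add_mono) (auto simp: le_fun_def)
          finally show ?thesis by simp
        qed
        then have "u (x + y) - u y \<le> q x" if "q \<in> C" for q
          using ge[of "u (x + y) - q x" y] le[OF that] by fastforce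
        then show "u (x + y) \<le> u x + u y"
          using ge[of "u (x + y) - u y" x] by simp
      next
        fix t :: real and x assume t: "t > 0"
        have "u (t *\<^sub>R x) / t \<le> q x" if "q \<in> C" for q
          using lower[OF that, of "t *\<^sub>R x"] sublinear_scale[OF CA(1)[OF that] t, of x] t
          by (simp add: field_simps)
        then show "u (t *\<^sub>R x) \<le> t * u x"
          using ge[of "u (t *\<^sub>R x) / t" x] t by (simp add: field_simps)
      qed
      moreover obtain q where "q \<in> C" using False by blast
      then have "u \<le> p" using lower CA(2) by (meson le_funI order_trans le_funD)
      ultimately have "u \<in> A" by (simp add: A_def)
      then show ?thesis using lower by (auto simp: le_fun_def)
    qed
  qed
  then obtain m where m: "sublinear m" "m \<le> p" "\<And>a. sublinear a \<Longrightarrow> a \<le> p \<Longrightarrow> a \<le> m \<Longrightarrow> a = m"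
    by (auto simp: A_def)
  then show thesis using that[of m] order_trans by blast
qed

lemma hahn_banach_sublinear:
  fixes p :: "'a::real_vector \<Rightarrow> real"
  assumes p: "sublinear p"
  obtains g where "linear g" "\<And>x. g x \<le> p x" "g v = p v"
proof -
  \<comment> \<open>Minimising below the modification along \<open>v\<close>, and not below \<open>p\<close> itself, bounds
    \<open>g (- v)\<close> by \<open>- p v\<close> and so forces equality at \<open>v\<close>.\<close>
  obtain g where g: "sublinear g" "g \<le> linearized p v" "\<And>q. sublinear q \<Longrightarrow> q \<le> g \<Longrightarrow> q = g"
    using minimal_sublinear_exists[OF sublinear_linearized[OF p]] by metis
  have fix_g: "linearized g y = g" for y
    using linearized_le[OF g(1), of 0 y] by (intro g(3) sublinear_linearized[OF g(1)]) (auto simp: le_fun_def)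
  have "g x + g y \<le> g (x + y)" for x y
    using linearized_le[OF g(1), of 1 y x] by (simp add: fix_g)
  then have add: "g (x + y) = g x + g y" for x y
    using sublinear_add[OF g(1), of x y] by (simp add: antisym)
  have neg: "g (- x) = - g x" for x
    using add[of x "- x"] sublinear_0[OF g(1)] by simp
  have scale: "g (t *\<^sub>R x) = t * g x" for t x
  proof -
    consider "t > 0" | "t = 0" | "- t > 0" by linarith
    then show ?thesis
    proof cases
      case 3
      then show ?thesis using sublinear_scale[OF g(1) 3, of x] neg[of "t *\<^sub>R x"] by simp
    qed (use sublinear_scale[OF g(1)] sublinear_0[OF g(1)] in auto)
  qed
  have le: "g x \<le> p x" for x
    using g(2) linearized_le[OF p, of 0 v x] by (auto simp: le_fun_def intro: order_trans)
  have "g (- v) \<le> p (- v + 1 *\<^sub>R v) - 1 * p v"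
    using g(2) linearized_le[OF p, of 1 v "- v"] by (auto simp: le_fun_def intro: order_trans)
  then have "p v \<le> g v" using sublinear_0[OF p] by (simp add: neg)
  then have "g v = p v" using le[of v] by simp
  moreover have "linear g" using add scale by (intro linearI) auto
  ultimately show thesis using that le by blast
qed

lemma infdist_greatest: "A \<noteq> {} \<Longrightarrow> (\<And>a. a \<in> A \<Longrightarrow> c \<le> dist x a) \<Longrightarrow> c \<le> infdist x A"
  by (simp add: infdist_notempty cINF_greatest)

text \<open>A real functional dominated by the distance to \<open>W\<close> is the real part of a complex one; that
  one, scaled, is the coefficient of the projection.\<close>

lemma projection_onto_line:
  fixes W :: "'a::complex_normed_vector set"
  assumes W: "csubspace W" "closed W" and v: "v \<notin> W"
  shows "\<exists>Q\<in>bounded_ops. (\<forall>x. blinfun_apply Q x \<in> cspan {v}) \<and> blinfun_apply Q v = v \<and>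
           (\<forall>w\<in>W. blinfun_apply Q w = 0)"
proof -
  let ?p = "\<lambda>x. infdist x W"
  have ne: "W \<noteq> {}" using complex_vector.subspace_0[OF W(1)] by auto
  have scale: "?p (c *\<^sub>C x) \<le> cmod c * ?p x" if "c \<noteq> 0" for c x
  proof -
    have "?p (c *\<^sub>C x) / cmod c \<le> ?p x"
    proof (rule infdist_greatest[OF ne])
      fix w assume w: "w \<in> W"
      have "?p (c *\<^sub>C x) \<le> dist (c *\<^sub>C x) (c *\<^sub>C w)"
        by (rule infdist_le[OF complex_vector.subspace_scale[OF W(1) w]])
      also have "\<dots> = cmod c * dist x w"
        by (simp add: dist_norm norm_scaleC flip: complex_vector.scale_right_diff_distrib)
      finally show "?p (c *\<^sub>C x) / cmod c \<le> dist x w" using that by (simp add: field_simps)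
    qed
    then show ?thesis using that by (simp add: field_simps)
  qed
  have sub: "sublinear ?p"
    unfolding sublinear_def
  proof (intro conjI allI impI)
    fix x y
    have le: "?p (x + y) - dist x w \<le> dist y z" if "w \<in> W" "z \<in> W" for w z
    proof -
      have "?p (x + y) \<le> dist (x + y) (w + z)"
        by (rule infdist_le[OF complex_vector.subspace_add[OF W(1) that]])
      also have "\<dots> \<le> dist x w + dist y z" by (rule dist_triangle_add)
      finally show ?thesis by simp
    qed
    then have "?p (x + y) - ?p y \<le> dist x w" if "w \<in> W" for w
      using infdist_greatest[OF ne, of "?p (x + y) - dist x w" y, OF le[OF that]] by simp
    then show "?p (x + y) \<le> ?p x + ?p y"
      using infdist_greatest[OF ne, of "?p (x + y) - ?p y" x] by simp
  next
    fix t :: real and x assume "t > 0"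
    then show "?p (t *\<^sub>R x) \<le> t * ?p x"
      using scale[of "complex_of_real t" x] by (simp add: scaleR_scaleC)
  qed
  obtain g where g: "linear g" "\<And>x. g x \<le> ?p x" "g v = ?p v"
    using hahn_banach_sublinear[OF sub] by metis
  have abs_g: "\<bar>g x\<bar> \<le> ?p x" for x
  proof -
    have "- g x = g (- x)" by (simp add: linear_neg[OF g(1)])
    also have "\<dots> \<le> ?p ((-1) *\<^sub>C x)"
      using g(2)[of "- x"] by (simp add: complex_vector.scale_minus_left)
    also have "\<dots> \<le> ?p x" using scale[of "-1" x] by simp
    finally show ?thesis using g(2)[of x] by linarith
  qed
  have norm_p: "?p x \<le> norm x" for x
    using infdist_le[OF complex_vector.subspace_0[OF W(1)], of x] by (simp add: dist_norm)
  \<comment> \<open>The only complex-linear functional with real part \<open>g\<close>.\<close>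
  define f where "f x = Complex (g x) (- g (\<i> *\<^sub>C x))" for x
  have f_add: "f (x + y) = f x + f y" for x y
    by (simp add: f_def linear_add[OF g(1)] scaleC_add_right complex_eq_iff)
  have f_scale: "f (c *\<^sub>C x) = c * f x" for c x
  proof -
    have "c *\<^sub>C x = Re c *\<^sub>R x + Im c *\<^sub>R (\<i> *\<^sub>C x)"
      by (simp add: scaleR_scaleC complex_eq mult.commute flip: scaleC_add_left)
    moreover have "\<i> *\<^sub>C (c *\<^sub>C x) = Re c *\<^sub>R (\<i> *\<^sub>C x) - Im c *\<^sub>R x"
      by (simp add: scaleR_scaleC complex_eq_iff flip: complex_vector.scale_left_diff_distrib)
    ultimately show ?thesis
      by (simp add: f_def linear_add[OF g(1)] linear_diff[OF g(1)] linear_scale[OF g(1)] complex_eq_iff)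
  qed
  have f_bound: "norm (f x) \<le> 2 * norm x" for x
  proof -
    have "norm (f x) \<le> \<bar>g x\<bar> + \<bar>g (\<i> *\<^sub>C x)\<bar>"
      using cmod_le[of "f x"] by (simp add: f_def)
    also have "\<dots> \<le> norm x + norm (\<i> *\<^sub>C x)"
      by (intro add_mono order_trans[OF abs_g norm_p])
    finally show ?thesis by (simp add: norm_scaleC)
  qed
  have "?p v > 0"
    using infdist_pos_not_in_closed[OF W(2) ne v] .
  then have fv: "f v \<noteq> 0" by (auto simp: f_def g(3) complex_eq_iff)
  have fW: "f w = 0" if "w \<in> W" for w
    using abs_g[of w] abs_g[of "\<i> *\<^sub>C w"] that complex_vector.subspace_scale[OF W(1) that, of \<i>]
    by (simp add: f_def complex_eq_iff)
  define q where "q x = (f x / f v) *\<^sub>C v" for x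
  have "bounded_linear q"
  proof (rule bounded_linear_intro[of _ "2 * norm v / cmod (f v)"])
    fix x y show "q (x + y) = q x + q y"
      by (simp add: q_def f_add add_divide_distrib scaleC_add_left)
  next
    fix r x show "q (r *\<^sub>R x) = r *\<^sub>R q x"
      by (simp add: q_def scaleR_scaleC f_scale scaleC_scaleC)
  next
    fix x
    have "norm (q x) = cmod (f x) * (norm v / cmod (f v))"
      by (simp add: q_def norm_scaleC norm_divide)
    also have "\<dots> \<le> (2 * norm x) * (norm v / cmod (f v))"
      by (intro mult_right_mono f_bound) simp
    finally show "norm (q x) \<le> norm x * (2 * norm v / cmod (f v))"
      by (simp add: mult_ac)
  qed
  then have Q: "blinfun_apply (Blinfun q) = q" by (rule bounded_linear_Blinfun_apply)
  show ?thesis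
  proof (intro bexI[of _ "Blinfun q"] conjI allI ballI)
    show "Blinfun q \<in> bounded_ops"
      by (simp add: bounded_ops_def Q q_def f_scale scaleC_scaleC)
    show "blinfun_apply (Blinfun q) x \<in> cspan {v}" for x
      unfolding Q q_def by (intro complex_vector.span_scale complex_vector.span_base) simp
    show "blinfun_apply (Blinfun q) v = v"
      unfolding Q q_def by (simp add: fv scaleC_one)
    show "blinfun_apply (Blinfun q) w = 0" if "w \<in> W" for w
      unfolding Q q_def by (simp add: fW that)
  qed
qed

text \<open>The range of a bounded projection is closed, so the next vector can again be separated from
  the span of the previous ones.\<close>

lemma projection_onto_fin_dim:
  fixes N :: "'a::complex_normed_vector set"
  assumes "fin_dim N"
  shows "\<exists>P\<in>bounded_ops. (\<forall>x. blinfun_apply P x \<in> N) \<and> (\<forall>x\<in>N. blinfun_apply P x = x)"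
proof -
  obtain F where F: "finite F" "N = cspan F" using assms by (auto simp: fin_dim_def)
  have "\<exists>P\<in>bounded_ops. (\<forall>x. blinfun_apply P x \<in> cspan F) \<and> (\<forall>x\<in>cspan F. blinfun_apply P x = x)"
    using F(1)
  proof (induction F rule: finite_induct)
    case empty
    show ?case by (intro bexI[of _ 0]) (auto simp: bounded_ops_def)
  next
    case (insert v F)
    then obtain P where P: "P \<in> bounded_ops" "\<And>x. blinfun_apply P x \<in> cspan F"
      "\<And>x. x \<in> cspan F \<Longrightarrow> blinfun_apply P x = x" by blast
    show ?case
    proof (cases "v \<in> cspan F")
      case True
      then show ?thesis using P complex_vector.span_redundant[OF True] by metis
    next
      case False
      have "cspan F = {x. blinfun_apply P x = x}"
        using P(2,3) by (metis (mono_tags) Collect_cong Collect_mem_eq)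
      then have "closed (cspan F)"
        by (metis closed_Collect_eq continuous_on_id linear_continuous_on blinfun.bounded_linear_right)
      then obtain Q where Q: "Q \<in> bounded_ops" "\<And>x. blinfun_apply Q x \<in> cspan {v}"
        "blinfun_apply Q v = v" "\<And>w. w \<in> cspan F \<Longrightarrow> blinfun_apply Q w = 0"
        using projection_onto_line[OF complex_vector.subspace_span _ False] by blast
      let ?R = "(P o\<^sub>L (id_blinfun - Q)) + Q"
      have R: "blinfun_apply ?R x = blinfun_apply P (x - blinfun_apply Q x) + blinfun_apply Q x" for x
        by (simp add: blinfun.add_left blinfun.diff_left)
      show ?thesis
      proof (intro bexI[of _ ?R] conjI allI ballI)
        show "?R \<in> bounded_ops"
          using P(1) Q(1) by (simp add: bounded_ops_def R scaleC_add_right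
              flip: complex_vector.scale_right_diff_distrib)
        show "blinfun_apply ?R x \<in> cspan (insert v F)" for x
          unfolding R using P(2) Q(2)
            complex_vector.span_mono[of F "insert v F"] complex_vector.span_mono[of "{v}" "insert v F"]
          by (intro complex_vector.span_add) auto
        fix x assume "x \<in> cspan (insert v F)"
        then obtain k where k: "x - k *\<^sub>C v \<in> cspan F"
          by (auto simp: complex_vector.span_insert)
        have "blinfun_apply Q x = blinfun_apply Q (x - k *\<^sub>C v) + k *\<^sub>C blinfun_apply Q v"
          using Q(1) by (simp add: blinfun.diff_right bounded_ops_def)
        then have "blinfun_apply Q x = k *\<^sub>C v" using Q(4)[OF k] Q(3) by simp
        then show "blinfun_apply ?R x = x" unfolding R using P(3)[OF k] by simp
      qed
    qed
  qed
  then show ?thesis using F(2) by blast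
qed

lemma closed_fin_dim:
  fixes N :: "'a::complex_normed_vector set"
  assumes "fin_dim N"
  shows "closed N"
proof -
  obtain P :: "'a \<Rightarrow>\<^sub>L 'a" where P: "\<And>x. blinfun_apply P x \<in> N" "\<And>x. x \<in> N \<Longrightarrow> blinfun_apply P x = x"
    using projection_onto_fin_dim[OF assms] by blast
  have "N = {x. blinfun_apply P x = x}" using P by (metis (mono_tags) Collect_cong Collect_mem_eq)
  then show ?thesis by (metis closed_Collect_eq continuous_on_id linear_continuous_on blinfun.bounded_linear_right)
qed

section \<open>The open mapping theorem\<close>

text \<open>By the Baire category theorem the image of some ball is dense in a ball; symmetry and
  convexity move that ball to the origin.  Approximate solutions with a halved error can then be
  summed to an exact one.\<close>

lemma open_mapping_on_subspace:
  fixes J :: "'e::banach \<Rightarrow>\<^sub>L 'b::banach"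
  assumes S: "subspace S" "closed S" and surj: "blinfun_apply J ` S = UNIV"
  obtains M where "M > 0" "\<And>y. \<exists>s\<in>S. blinfun_apply J s = y \<and> norm s \<le> M * norm y"
proof -
  define T where "T n = closure (blinfun_apply J ` (S \<inter> cball 0 (real n)))" for n
  have "\<exists>n. interior (T n) \<noteq> {}"
  proof (rule ccontr)
    assume "\<not> (\<exists>n. interior (T n) \<noteq> {})"
    then have "euclidean interior_of \<Union>(range T) = {}"
      by (intro Baire_category_alt disjI1 completely_metrizable_space_euclidean) (auto simp: T_def)
    moreover have "y \<in> \<Union>(range T)" for y
    proof -
      obtain s where s: "s \<in> S" "y = blinfun_apply J s" using surj by (metis UNIV_I imageE)
      obtain n where "norm s \<le> real n" using real_arch_simple by blast
      then have "y \<in> T n"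
        unfolding T_def using s by (intro subsetD[OF closure_subset]) auto
      then show ?thesis by blast
    qed
    then have "\<Union>(range T) = UNIV" by blast
    ultimately show False by simp
  qed
  then obtain n a where "a \<in> interior (T n)" by blast
  then obtain r where r: "r > 0" "ball a r \<subseteq> T n"
    by (metis interior_subset mem_interior open_interior subset_trans)
  have approx: "\<exists>s\<in>S. norm s \<le> real n \<and> norm (y - blinfun_apply J s) < e"
    if y: "norm y < r" and e: "e > 0" for y e
  proof -
    have "a + y \<in> T n" "a - y \<in> T n"
      using r(2) y by (auto simp: dist_norm)
    then obtain s t where s: "s \<in> S" "norm s \<le> real n" "dist (blinfun_apply J s) (a + y) < e"
      and t: "t \<in> S" "norm t \<le> real n" "dist (blinfun_apply J t) (a - y) < e"
      using e unfolding T_def closure_approachable by fastforce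
    let ?u = "(1 / 2) *\<^sub>R (s - t)"
    have "?u \<in> S" using s t S(1) by (simp add: subspace_diff subspace_scale)
    moreover have "norm ?u \<le> real n"
      using norm_triangle_ineq4[of s t] s t by simp
    moreover have "norm (y - blinfun_apply J ?u) < e"
    proof -
      have "y - blinfun_apply J ?u = (1 / 2) *\<^sub>R ((a + y - blinfun_apply J s) - (a - y - blinfun_apply J t))"
        by (simp add: blinfun.scaleR_right blinfun.diff_right algebra_simps flip: scaleR_2)
      also have "norm \<dots> \<le> (1 / 2) * (norm (a + y - blinfun_apply J s) + norm (a - y - blinfun_apply J t))"
        unfolding norm_scaleR by (intro mult_mono norm_triangle_ineq4) auto
      also have "\<dots> < e" using s t by (simp add: dist_norm norm_minus_commute)
      finally show ?thesis .
    qed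
    ultimately show ?thesis by blast
  qed
  \<comment> \<open>Rescaling \<open>y\<close> to norm \<open>r / 2\<close> costs the factor \<open>2 / r\<close>; the summand 1 keeps
    the constant positive when \<open>n = 0\<close>.\<close>
  define K where "K = 2 * (real n + 1) / r"
  have K: "K > 0" using r by (simp add: K_def)
  have "\<exists>s\<in>S. norm s \<le> K * norm y \<and> norm (y - blinfun_apply J s) \<le> norm y / 2" for y
  proof (cases "y = 0")
    case True
    then show ?thesis using subspace_0[OF S(1)] by (intro bexI[of _ 0]) auto
  next
    case False
    define c where "c = r / (2 * norm y)"
    have c: "c > 0" "norm (c *\<^sub>R y) < r" using False r by (auto simp: c_def)
    obtain s where s: "s \<in> S" "norm s \<le> real n" "norm (c *\<^sub>R y - blinfun_apply J s) < c * (norm y / 2)"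
      using approx[OF c(2), of "c * (norm y / 2)"] c False by auto
    let ?u = "(1 / c) *\<^sub>R s"
    have "norm ?u = norm s * (2 * norm y / r)"
      using r(1) by (simp add: c_def)
    also have "\<dots> \<le> (real n + 1) * (2 * norm y / r)"
      using s(2) r(1) by (intro mult_right_mono) auto
    finally have "norm ?u \<le> K * norm y" by (simp add: K_def mult_ac)
    moreover have "y - blinfun_apply J ?u = (1 / c) *\<^sub>R (c *\<^sub>R y - blinfun_apply J s)"
      using c by (simp add: blinfun.scaleR_right scaleR_diff_right)
    then have "norm (y - blinfun_apply J ?u) = (1 / c) * norm (c *\<^sub>R y - blinfun_apply J s)"
      using c by simp
    then have "c * norm (y - blinfun_apply J ?u) < c * (norm y / 2)"
      using s(3) c by simp
    then have "norm (y - blinfun_apply J ?u) \<le> norm y / 2"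
      using c by (simp only: mult_less_cancel_left_pos less_imp_le)
    ultimately show ?thesis using s(1) S(1) by (intro bexI[of _ ?u]) (auto simp: subspace_scale)
  qed
  then obtain \<sigma> where \<sigma>: "\<And>y. \<sigma> y \<in> S" "\<And>y. norm (\<sigma> y) \<le> K * norm y"
    "\<And>y. norm (y - blinfun_apply J (\<sigma> y)) \<le> norm y / 2" by metis
  have "\<exists>s\<in>S. blinfun_apply J s = y \<and> norm s \<le> (2 * K) * norm y" for y
  proof -
    \<comment> \<open>The error that remains after \<open>k\<close> approximation steps.\<close>
    define z where "z k = ((\<lambda>y. y - blinfun_apply J (\<sigma> y)) ^^ k) y" for k
    have z0: "z 0 = y" and zSuc: "z (Suc k) = z k - blinfun_apply J (\<sigma> (z k))" for k
      by (simp_all add: z_def)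
    have nz: "norm (z k) \<le> norm y * (1 / 2) ^ k" for k
    proof (induction k)
      case (Suc k)
      then show ?case using \<sigma>(3)[of "z k"] by (simp add: zSuc)
    qed (simp add: z0)
    have n\<sigma>: "norm (\<sigma> (z k)) \<le> K * norm y * (1 / 2) ^ k" for k
    proof -
      have "norm (\<sigma> (z k)) \<le> K * norm (z k)" by (rule \<sigma>(2))
      also have "\<dots> \<le> K * (norm y * (1 / 2) ^ k)" using nz K by (intro mult_left_mono) auto
      finally show ?thesis by (simp add: mult_ac)
    qed
    have geo: "(\<lambda>k. K * norm y * (1 / 2) ^ k) sums (K * norm y * 2)"
      using sums_mult[OF geometric_sums[of "1 / 2 :: real"], of "K * norm y"] by simp
    have sumb: "summable (\<lambda>k. \<sigma> (z k))"
      using n\<sigma> by (intro summable_comparison_test'[OF sums_summable[OF geo]])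
    define s where "s = (\<Sum>k. \<sigma> (z k))"
    have s: "(\<lambda>k. \<sigma> (z k)) sums s" unfolding s_def using sumb by (rule summable_sums)
    have "s \<in> S"
    proof (rule closed_sequentially[OF S(2)])
      show "(\<Sum>k<n. \<sigma> (z k)) \<in> S" for n
        using \<sigma>(1) by (intro subspace_sum[OF S(1)])
      show "(\<lambda>n. \<Sum>k<n. \<sigma> (z k)) \<longlonglongrightarrow> s" using s by (simp add: sums_def)
    qed
    moreover have "norm s \<le> (2 * K) * norm y"
      using norm_suminf_le[OF n\<sigma> sums_summable[OF geo]] sums_unique[OF geo] by (simp add: s_def mult_ac)
    moreover have "blinfun_apply J s = y"
    proof -
      have "(\<lambda>k. norm y * (1 / 2) ^ k) \<longlonglongrightarrow> 0"
        by (intro tendsto_mult_right_zero LIMSEQ_power_zero) simp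
      then have "z \<longlonglongrightarrow> 0"
        by (rule Lim_null_comparison[OF always_eventually[OF allI[OF nz]]])
      then have "(\<lambda>k. z k - z (Suc k)) sums (z 0 - 0)" by (rule telescope_sums')
      then have "(\<lambda>k. blinfun_apply J (\<sigma> (z k))) sums y" by (simp add: zSuc z0)
      moreover have "(\<lambda>k. blinfun_apply J (\<sigma> (z k))) sums blinfun_apply J s"
        by (rule bounded_linear.sums[OF blinfun.bounded_linear_right s])
      ultimately show ?thesis by (rule sums_unique2[symmetric])
    qed
    ultimately show ?thesis by blast
  qed
  moreover have "2 * K > 0" using K by simp
  ultimately show thesis using that by blast
qed

section \<open>Parametrices and stability of the index\<close>

text \<open>The map \<open>(l, c) \<mapsto> T l + c\<close> is a bounded bijection from \<open>L \<times> C\<close> onto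
  the target when \<open>L\<close> is a closed complement of the kernel and \<open>C\<close> a complement of the
  range.  The open mapping theorem bounds its inverse, whose first component is \<open>H\<close>.\<close>

lemma bounded_partial_inverse:
  fixes T :: "'a::cbanach \<Rightarrow>\<^sub>L 'b::cbanach"
  assumes "finite_defects T"
  obtains L N C H where "complementary L N" "fin_dim N" "complementary (blinfun_apply T ` L) C"
    "fin_dim C" "\<And>n. n \<in> N \<Longrightarrow> blinfun_apply T n = 0" "H \<in> bounded_ops"
    "\<And>l c. l \<in> L \<Longrightarrow> c \<in> C \<Longrightarrow> blinfun_apply H (blinfun_apply T l + c) = l"
proof -
  have T: "T \<in> bounded_ops" and N: "fin_dim (ker T)"
    using assms by (auto simp: finite_defects_def)
  obtain C where RC: "complementary (range (blinfun_apply T)) C" and C: "fin_dim C"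
    using assms by (auto simp: finite_defects_def)
  obtain P :: "'a \<Rightarrow>\<^sub>L 'a" where P: "P \<in> bounded_ops" "\<And>x. blinfun_apply P x \<in> ker T"
    "\<And>x. x \<in> ker T \<Longrightarrow> blinfun_apply P x = x"
    using projection_onto_fin_dim[OF N] by blast
  define L where "L = ker P"
  have sL: "csubspace L" and sN: "csubspace (ker T)" and sC: "csubspace C"
    using csubspace_ker[OF P(1)] csubspace_ker[OF T] RC by (auto simp: L_def complementary_def)
  have LN: "complementary L (ker T)"
    unfolding complementary_def
  proof (intro conjI sL sN equalityI subset_UNIV subsetI)
    fix x assume x: "x \<in> L \<inter> ker T"
    then show "x \<in> {0}" using P(3)[of x] by (simp add: L_def ker_def)
  next
    fix x
    have "x - blinfun_apply P x \<in> L"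
      using P(3)[OF P(2)] by (simp add: L_def ker_def blinfun.diff_right)
    then show "x \<in> L + ker T"
      using P(2)[of x] set_plus_intro[of "x - blinfun_apply P x" L "blinfun_apply P x" "ker T"] by simp
  qed
  have TL: "range (blinfun_apply T) = blinfun_apply T ` L"
  proof (intro equalityI subsetI)
    fix y assume "y \<in> range (blinfun_apply T)"
    then obtain x where x: "y = blinfun_apply T x" by auto
    obtain l n where "l \<in> L" "n \<in> ker T" "x = l + n" using complementary_split[OF LN] by metis
    then show "y \<in> blinfun_apply T ` L" by (simp add: x ker_def blinfun.add_right)
  qed auto
  have RC': "complementary (blinfun_apply T ` L) C" using RC TL by simp
  have zero: "l = 0" if "l \<in> L" "c \<in> C" "blinfun_apply T l + c = 0" for l c
  proof -
    have "blinfun_apply T l = 0"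
      using complementary_0(1)[OF RC' _ that(2,3)] that(1) by simp
    then show ?thesis using that(1) LN by (auto simp: complementary_def ker_def)
  qed
  \<comment> \<open>Both factors have to be closed for the open mapping theorem: \<open>L\<close> is the kernel of a
    bounded projection, and \<open>C\<close> has finite dimension.\<close>
  let ?J = "(T o\<^sub>L fst_blinfun) + snd_blinfun :: ('a \<times> 'b) \<Rightarrow>\<^sub>L 'b"
  have J: "blinfun_apply ?J p = blinfun_apply T (fst p) + snd p" for p
    by (simp add: blinfun.add_left)
  have real_sub: "subspace W" if "csubspace W" for W :: "'c::complex_vector set"
    using that complex_vector.subspace_scale[OF that, of _ "complex_of_real _"]
    by (auto simp: complex_vector.subspace_def subspace_def scaleR_scaleC)
  have "subspace (L \<times> C)"
    by (intro subspace_Times real_sub sL sC)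
  moreover have "closed (L \<times> C)"
  proof (rule closed_Times[OF _ closed_fin_dim[OF C]])
    show "closed L"
      unfolding L_def ker_def
      by (intro closed_Collect_eq linear_continuous_on blinfun.bounded_linear_right continuous_on_const)
  qed
  moreover have "blinfun_apply ?J ` (L \<times> C) = UNIV"
  proof (intro equalityI subset_UNIV subsetI)
    fix y
    obtain t c where "t \<in> blinfun_apply T ` L" "c \<in> C" "y = t + c"
      using complementary_split[OF RC'] by metis
    then show "y \<in> blinfun_apply ?J ` (L \<times> C)" by (force simp: J)
  qed
  ultimately obtain M where M: "M > 0" "\<And>y. \<exists>s\<in>L \<times> C. blinfun_apply ?J s = y \<and> norm s \<le> M * norm y"
    using open_mapping_on_subspace[of "L \<times> C" ?J] by metis
  have "\<exists>l. l \<in> L \<and> (\<exists>c\<in>C. y = blinfun_apply T l + c) \<and> norm l \<le> M * norm y" for y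
  proof -
    obtain l c where lc: "l \<in> L" "c \<in> C" "blinfun_apply T l + c = y" "norm (l, c) \<le> M * norm y"
      using M(2)[of y] by (auto simp: J)
    then show ?thesis using norm_fst_le[of l c] by (metis order_trans)
  qed
  then obtain h where h: "\<And>y. h y \<in> L" "\<And>y. \<exists>c\<in>C. y = blinfun_apply T (h y) + c"
    "\<And>y. norm (h y) \<le> M * norm y" by metis
  have h_eq: "h (blinfun_apply T l + c) = l" if lc: "l \<in> L" "c \<in> C" for l c
  proof -
    obtain d where d: "d \<in> C" "blinfun_apply T l + c = blinfun_apply T (h (blinfun_apply T l + c)) + d"
      by (rule bexE[OF h(2)])
    then have "blinfun_apply T (l - h (blinfun_apply T l + c)) + (c - d) = 0"
      by (simp add: blinfun.diff_right algebra_simps)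
    then have "l - h (blinfun_apply T l + c) = 0"
      by (intro zero[OF complex_vector.subspace_diff[OF sL lc(1) h(1)]
            complex_vector.subspace_diff[OF sC lc(2) d(1)]])
    then show ?thesis by simp
  qed
  have h_add: "h (x + y) = h x + h y" for x y
  proof -
    obtain c where c: "c \<in> C" "x = blinfun_apply T (h x) + c" by (rule bexE[OF h(2)[of x]])
    obtain d where d: "d \<in> C" "y = blinfun_apply T (h y) + d" by (rule bexE[OF h(2)[of y]])
    have "x + y = (blinfun_apply T (h x) + c) + (blinfun_apply T (h y) + d)"
      using c(2) d(2) by (rule arg_cong2[where f = "(+)"])
    also have "\<dots> = blinfun_apply T (h x + h y) + (c + d)"
      by (simp add: blinfun.add_right)
    finally have "h (x + y) = h (blinfun_apply T (h x + h y) + (c + d))" by (rule arg_cong)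
    also have "\<dots> = h x + h y"
      by (rule h_eq[OF complex_vector.subspace_add[OF sL h(1) h(1)] complex_vector.subspace_add[OF sC c(1) d(1)]])
    finally show ?thesis .
  qed
  have h_scale: "h (k *\<^sub>C x) = k *\<^sub>C h x" for k x
  proof -
    obtain c where c: "c \<in> C" "x = blinfun_apply T (h x) + c" by (rule bexE[OF h(2)[of x]])
    have "k *\<^sub>C x = k *\<^sub>C (blinfun_apply T (h x) + c)"
      using c(2) by (rule arg_cong)
    also have "\<dots> = blinfun_apply T (k *\<^sub>C h x) + k *\<^sub>C c"
      using T by (simp add: scaleC_add_right bounded_ops_def)
    finally have "h (k *\<^sub>C x) = h (blinfun_apply T (k *\<^sub>C h x) + k *\<^sub>C c)" by (rule arg_cong)
    also have "\<dots> = k *\<^sub>C h x"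
      by (rule h_eq[OF complex_vector.subspace_scale[OF sL h(1)] complex_vector.subspace_scale[OF sC c(1)]])
    finally show ?thesis .
  qed
  have "bounded_linear h"
    using h_add h_scale h(3) by (intro bounded_linear_intro[of _ M]) (auto simp: scaleR_scaleC mult.commute)
  then have H: "blinfun_apply (Blinfun h) = h" by (rule bounded_linear_Blinfun_apply)
  show thesis
  proof (rule that[OF LN N RC' C])
    show "blinfun_apply T n = 0" if "n \<in> ker T" for n using that by (simp add: ker_def)
    show "Blinfun h \<in> bounded_ops" by (simp add: bounded_ops_def H h_scale)
    show "blinfun_apply (Blinfun h) (blinfun_apply T l + c) = l" if "l \<in> L" "c \<in> C" for l c
      using that by (simp add: H h_eq)
  qed
qed

text \<open>A small perturbation of the operator changes \<open>(l, c) \<mapsto> T l + c\<close> into an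
  isomorphism again, so the same \<open>L\<close>, \<open>N\<close> and \<open>C\<close> compute the index.\<close>

lemma ind_locally_constant:
  fixes T :: "'a::cbanach \<Rightarrow>\<^sub>L 'b::cbanach"
  assumes "finite_defects T"
  obtains e where "e > 0"
    "\<And>T'. T' \<in> bounded_ops \<Longrightarrow> dist T' T < e \<Longrightarrow> ind T' = ind T"
proof -
  obtain L N C H where LN: "complementary L N" "fin_dim N"
    and TC: "complementary (blinfun_apply T ` L) C" "fin_dim C"
    and HT: "\<And>l c. l \<in> L \<Longrightarrow> c \<in> C \<Longrightarrow> blinfun_apply H (blinfun_apply T l + c) = l"
    using bounded_partial_inverse[OF assms] by metis
  have T: "T \<in> bounded_ops" using assms by (simp add: finite_defects_def)
  have sL: "csubspace L" and sC: "csubspace C" using LN TC by (auto simp: complementary_def)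
  have indT: "ind T = int (cdim N) - int (cdim C)"
  proof (rule ind_by_restriction(2)[OF T LN TC])
    fix x assume "x \<in> L" "blinfun_apply T x = 0"
    then show "x = 0" using HT[of x 0] complex_vector.subspace_0[OF sC] by (simp add: blinfun.zero_right)
  qed
  have ind: "ind T' = ind T" if T': "T' \<in> bounded_ops" and close: "dist T' T < 1 / (norm H + 1)" for T'
  proof -
    \<comment> \<open>In terms of \<open>z = T l + c\<close> the perturbed map \<open>T' l + c\<close> reads \<open>z + D z\<close>,
      and \<open>I + D\<close> is bijective because \<open>D\<close> is a contraction.\<close>
    define D where "D = (T' - T) o\<^sub>L H"
    have "norm D \<le> norm (T' - T) * norm H" unfolding D_def by (rule norm_blinfun_compose)
    also have "\<dots> \<le> 1 / (norm H + 1) * norm H"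
      using close by (intro mult_right_mono) (auto simp: dist_norm)
    also have "\<dots> < 1"
    proof -
      have "norm H + 1 > 0" using norm_ge_zero[of H] by linarith
      then show ?thesis by (simp add: pos_divide_less_eq)
    qed
    finally have D1: "norm D < 1" .
    have solve: "\<exists>!z. y - blinfun_apply D z = z" for y
    proof (rule banach_fix_type[OF norm_ge_zero D1], intro allI)
      fix u v
      have "norm (blinfun_apply D (v - u)) \<le> norm D * norm (v - u)" by (rule norm_blinfun)
      then show "dist (y - blinfun_apply D u) (y - blinfun_apply D v) \<le> norm D * dist u v"
        by (simp add: dist_norm blinfun.diff_right norm_minus_commute)
    qed
    have D: "blinfun_apply T' l + c = (blinfun_apply T l + c) + blinfun_apply D (blinfun_apply T l + c)"
      if "l \<in> L" "c \<in> C" for l c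
      using HT[OF that] by (simp add: D_def blinfun.diff_left)
    have inj: "l = 0" "c = 0" if lc: "l \<in> L" "c \<in> C" "blinfun_apply T' l + c = 0" for l c
    proof -
      let ?z = "blinfun_apply T l + c"
      have "?z + blinfun_apply D ?z = 0" using D[OF lc(1,2)] lc(3) by (rule trans[OF sym])
      then have "0 - blinfun_apply D ?z = ?z" by (metis add_diff_cancel_right')
      moreover have "0 - blinfun_apply D 0 = 0" by (simp add: blinfun.zero_right)
      ultimately have "?z = 0" using solve[of 0] by blast
      then show "l = 0" using HT[OF lc(1,2)] by (simp add: blinfun.zero_right)
      then show "c = 0" using lc(3) by (simp add: blinfun.zero_right)
    qed
    have "complementary (blinfun_apply T' ` L) C"
      unfolding complementary_def
    proof (intro conjI sC csubspace_image[OF T' sL] equalityI subset_UNIV subsetI)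
      fix x assume x: "x \<in> blinfun_apply T' ` L \<inter> C"
      then obtain l where l: "l \<in> L" "x = blinfun_apply T' l" by auto
      have "- x \<in> C" using x complex_vector.subspace_neg[OF sC] by auto
      then have "l = 0" using inj(1)[OF l(1), of "- x"] l(2) by simp
      then show "x \<in> {0}" using l(2) by (simp add: blinfun.zero_right)
    next
      fix y
      obtain z where z: "y - blinfun_apply D z = z" using solve[of y] by blast
      obtain t c where "t \<in> blinfun_apply T ` L" and c: "c \<in> C" "z = t + c"
        using complementary_split[OF TC(1)] by metis
      then obtain l where l: "l \<in> L" "z = blinfun_apply T l + c" by auto
      have "y = z + blinfun_apply D z" using z by (metis diff_add_cancel)
      then have "y = blinfun_apply T' l + c" using D[OF l(1) c(1)] l(2) by simp
      then show "y \<in> blinfun_apply T' ` L + C" using l c by auto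
    qed
    from ind_by_restriction(2)[OF T' LN this TC(2)] show ?thesis
      using inj(1)[OF _ complex_vector.subspace_0[OF sC]] by (simp add: indT)
  qed
  have "norm H + 1 > 0" using norm_ge_zero[of H] by linarith
  then have "1 / (norm H + 1) > 0" by simp
  then show thesis using that ind by blast
qed

lemma ind_constant_on_connected:
  fixes T :: "'i::topological_space \<Rightarrow> ('a::cbanach \<Rightarrow>\<^sub>L 'b::cbanach)"
  assumes I: "connected I" "i \<in> I" "j \<in> I" and cont: "continuous_on I T"
    and fin: "\<And>i. i \<in> I \<Longrightarrow> finite_defects (T i)"
  shows "ind (T i) = ind (T j)"
proof (rule connected_local_const[OF I], intro ballI)
  fix k assume k: "k \<in> I"
  obtain e where e: "e > 0" "\<And>T'. T' \<in> bounded_ops \<Longrightarrow> dist T' (T k) < e \<Longrightarrow> ind T' = ind (T k)"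
    using ind_locally_constant[OF fin[OF k]] by metis
  have "(T \<longlongrightarrow> T k) (at k within I)"
    using cont k by (simp add: continuous_on_def)
  then have "\<forall>\<^sub>F l in at k within I. dist (T l) (T k) < e"
    using e(1) by (rule tendstoD)
  moreover have "\<forall>\<^sub>F l in at k within I. l \<in> I"
    by (simp add: eventually_at_filter)
  ultimately show "\<forall>\<^sub>F l in at k within I. ind (T k) = ind (T l)"
  proof eventually_elim
    case (elim l)
    then show ?case using e(2)[of "T l"] fin[of l] by (simp add: finite_defects_def)
  qed
qed

section \<open>Invertibility modulo finite rank\<close>

lemma bounded_ops_id: "id_blinfun \<in> bounded_ops"
  by (simp add: bounded_ops_def)

lemma bounded_ops_compose: "S \<in> bounded_ops \<Longrightarrow> T \<in> bounded_ops \<Longrightarrow> S o\<^sub>L T \<in> bounded_ops"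
  by (simp add: bounded_ops_def)

lemma bounded_ops_add: "S \<in> bounded_ops \<Longrightarrow> T \<in> bounded_ops \<Longrightarrow> S + T \<in> bounded_ops"
  by (simp add: bounded_ops_def blinfun.add_left scaleC_add_right)

lemma bounded_ops_diff: "S \<in> bounded_ops \<Longrightarrow> T \<in> bounded_ops \<Longrightarrow> S - T \<in> bounded_ops"
  by (simp add: bounded_ops_def blinfun.diff_left complex_vector.scale_right_diff_distrib)

lemma bounded_ops_scaleR: "T \<in> bounded_ops \<Longrightarrow> r *\<^sub>R T \<in> bounded_ops"
  by (simp add: bounded_ops_def blinfun.scaleR_left scaleR_scaleC scaleC_scaleC mult.commute)

lemmas bounded_ops_intros =
  bounded_ops_id bounded_ops_compose bounded_ops_add bounded_ops_diff bounded_ops_scaleR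

definition finite_rank :: "('a::complex_normed_vector \<Rightarrow>\<^sub>L 'b::complex_normed_vector) \<Rightarrow> bool" where
  "finite_rank F \<longleftrightarrow> F \<in> bounded_ops \<and> fin_dim (range (blinfun_apply F))"

lemma finite_rankI:
  assumes "F \<in> bounded_ops" and "fin_dim N" and "\<And>x. blinfun_apply F x \<in> N"
  shows "finite_rank F"
  unfolding finite_rank_def using assms
  by (auto intro: fin_dim_subset csubspace_image[OF _ complex_vector.subspace_UNIV])

lemma finite_rank_add:
  assumes "finite_rank F" and "finite_rank G"
  shows "finite_rank (F + G)"
proof (rule finite_rankI)
  show "F + G \<in> bounded_ops"
    using assms by (auto simp: finite_rank_def intro: bounded_ops_add)
  show "fin_dim (range (blinfun_apply F) + range (blinfun_apply G))"
    using assms by (auto simp: finite_rank_def intro: fin_dim_plus)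
  show "blinfun_apply (F + G) x \<in> range (blinfun_apply F) + range (blinfun_apply G)" for x
    by (auto simp: blinfun.add_left)
qed

lemma finite_rank_compose_left:
  assumes "finite_rank F" and "S \<in> bounded_ops"
  shows "finite_rank (S o\<^sub>L F)"
proof (rule finite_rankI)
  show "S o\<^sub>L F \<in> bounded_ops"
    using assms by (auto simp: finite_rank_def intro: bounded_ops_compose)
  show "fin_dim (blinfun_apply S ` range (blinfun_apply F))"
    using assms by (auto simp: finite_rank_def intro: fin_dim_image clinear_bounded_ops)
qed simp

lemma finite_rank_compose_right:
  assumes "finite_rank F" and "S \<in> bounded_ops"
  shows "finite_rank (F o\<^sub>L S)"
proof (rule finite_rankI)
  show "F o\<^sub>L S \<in> bounded_ops"
    using assms by (auto simp: finite_rank_def intro: bounded_ops_compose)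
  show "fin_dim (range (blinfun_apply F))"
    using assms by (simp add: finite_rank_def)
qed simp

lemma finite_rank_uminus:
  assumes "finite_rank F"
  shows "finite_rank (- F)"
proof -
  have "- F = ((- 1) *\<^sub>R id_blinfun) o\<^sub>L F"
    by (rule blinfun_eqI) (simp add: blinfun.bilinear_simps)
  then show ?thesis
    using finite_rank_compose_left[OF assms bounded_ops_scaleR[OF bounded_ops_id]] by (simp only:)
qed

lemma parametrix_exists:
  fixes T :: "'a::cbanach \<Rightarrow>\<^sub>L 'b::cbanach"
  assumes "finite_defects T"
  obtains H where "H \<in> bounded_ops" "finite_rank (id_blinfun - (H o\<^sub>L T))"
    "finite_rank (id_blinfun - (T o\<^sub>L H))"
proof -
  obtain L N C H where LN: "complementary L N" "fin_dim N"
    and TC: "complementary (blinfun_apply T ` L) C" "fin_dim C"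
    and N: "\<And>n. n \<in> N \<Longrightarrow> blinfun_apply T n = 0" and H: "H \<in> bounded_ops"
    and HT: "\<And>l c. l \<in> L \<Longrightarrow> c \<in> C \<Longrightarrow> blinfun_apply H (blinfun_apply T l + c) = l"
    using bounded_partial_inverse[OF assms] by metis
  have T: "T \<in> bounded_ops" using assms by (simp add: finite_defects_def)
  have 0: "0 \<in> C" using TC by (simp add: complementary_def complex_vector.subspace_0)
  show thesis
  proof (rule that[OF H])
    show "finite_rank (id_blinfun - (H o\<^sub>L T))"
    proof (rule finite_rankI[OF _ LN(2)])
      show "id_blinfun - (H o\<^sub>L T) \<in> bounded_ops" using T H by (intro bounded_ops_intros)
      fix x
      obtain l n where x: "l \<in> L" "n \<in> N" "x = l + n" using complementary_split[OF LN(1)] by metis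
      then have "blinfun_apply (id_blinfun - (H o\<^sub>L T)) x = n"
        using HT[OF x(1) 0] N[OF x(2)] by (simp add: blinfun.diff_left blinfun.add_right)
      then show "blinfun_apply (id_blinfun - (H o\<^sub>L T)) x \<in> N" using x by simp
    qed
    show "finite_rank (id_blinfun - (T o\<^sub>L H))"
    proof (rule finite_rankI[OF _ TC(2)])
      show "id_blinfun - (T o\<^sub>L H) \<in> bounded_ops" using T H by (intro bounded_ops_intros)
      fix y
      obtain t c where "t \<in> blinfun_apply T ` L" and c: "c \<in> C" "y = t + c"
        using complementary_split[OF TC(1)] by metis
      then obtain l where l: "l \<in> L" "y = blinfun_apply T l + c" by auto
      have "blinfun_apply (id_blinfun - (T o\<^sub>L H)) y = c"
        using HT[OF l(1) c(1)] by (simp add: blinfun.diff_left l(2))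
      then show "blinfun_apply (id_blinfun - (T o\<^sub>L H)) y \<in> C" using c by simp
    qed
  qed
qed

text \<open>Where \<open>HT\<close> differs from the identity by finite rank, the kernel of \<open>T\<close> lies in the
  range of the difference; where \<open>TH'\<close> does, the range of the difference covers the cokernel.\<close>

lemma finite_defects_of_parametrices:
  assumes T: "T \<in> bounded_ops"
    and left: "finite_rank (id_blinfun - (H o\<^sub>L T))"
    and right: "finite_rank (id_blinfun - (T o\<^sub>L H'))"
  shows "finite_defects T"
proof -
  let ?F = "id_blinfun - (H o\<^sub>L T)" and ?G = "id_blinfun - (T o\<^sub>L H')"
  have "ker T \<subseteq> range (blinfun_apply ?F)"
  proof
    fix x assume "x \<in> ker T"
    then have "blinfun_apply ?F x = x" by (simp add: ker_def blinfun.diff_left blinfun.zero_right)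
    then show "x \<in> range (blinfun_apply ?F)" by (metis rangeI)
  qed
  then have ker: "fin_dim (ker T)"
    using left fin_dim_subset[OF _ csubspace_ker[OF T]] unfolding finite_rank_def by blast
  obtain C where C: "complementary (range (blinfun_apply T)) C"
    using complementary_exists[OF csubspace_image[OF T complex_vector.subspace_UNIV]] by blast
  obtain p where p: "clinear p" "\<And>x. p x \<in> C" "\<And>c. c \<in> C \<Longrightarrow> p c = c"
    "\<And>y. y \<in> range (blinfun_apply T) \<Longrightarrow> p y = 0"
    using complementary_projection[OF C] by metis
  have "C \<subseteq> p ` range (blinfun_apply ?G)"
  proof
    fix c assume c: "c \<in> C"
    have "p c = p (blinfun_apply T (blinfun_apply H' c)) + p (blinfun_apply ?G c)"
      by (simp add: blinfun.diff_left flip: clin.linear_add[OF p(1)])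
    then have "c = p (blinfun_apply ?G c)" using p(3)[OF c] p(4) by simp
    then show "c \<in> p ` range (blinfun_apply ?G)" by blast
  qed
  then have "fin_dim C"
    using right fin_dim_subset[OF fin_dim_image[OF p(1)]] C
    unfolding finite_rank_def complementary_def by blast
  then show ?thesis using T ker C by (auto simp: finite_defects_def)
qed

text \<open>Fredholmness is invertibility modulo finite rank, so it passes from products to the factor
  that they share.\<close>

lemma finite_defects_of_products:
  fixes T :: "'a::cbanach \<Rightarrow>\<^sub>L 'b::cbanach" and H H' :: "'b \<Rightarrow>\<^sub>L 'a"
  assumes T: "T \<in> bounded_ops" and H: "H \<in> bounded_ops" "H' \<in> bounded_ops"
    and left: "finite_defects (H o\<^sub>L T)" and right: "finite_defects (T o\<^sub>L H')"
  shows "finite_defects T"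
proof -
  have assoc: "(P o\<^sub>L Q) o\<^sub>L R = P o\<^sub>L (Q o\<^sub>L R)"
    for P :: "'d::real_normed_vector \<Rightarrow>\<^sub>L 'e::real_normed_vector"
      and Q :: "'f::real_normed_vector \<Rightarrow>\<^sub>L 'd" and R :: "'g::real_normed_vector \<Rightarrow>\<^sub>L 'f"
    by (rule blinfun_eqI) simp
  obtain G where G: "finite_rank (id_blinfun - (G o\<^sub>L (H o\<^sub>L T)))"
    using parametrix_exists[OF left] by metis
  obtain G' where G': "finite_rank (id_blinfun - ((T o\<^sub>L H') o\<^sub>L G'))"
    using parametrix_exists[OF right] by metis
  show ?thesis
    by (rule finite_defects_of_parametrices[OF T, of "G o\<^sub>L H" "H' o\<^sub>L G'"])
      (use G G' in \<open>simp_all only: assoc\<close>)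
qed

lemma finite_defects_add_finite_rank:
  fixes T :: "'a::cbanach \<Rightarrow>\<^sub>L 'b::cbanach"
  assumes "finite_defects T" and F: "finite_rank F"
  shows "finite_defects (T + F)"
proof -
  obtain H where H: "H \<in> bounded_ops" "finite_rank (id_blinfun - (H o\<^sub>L T))"
    "finite_rank (id_blinfun - (T o\<^sub>L H))"
    using parametrix_exists[OF assms(1)] by metis
  have T: "T \<in> bounded_ops" and Fb: "F \<in> bounded_ops"
    using assms by (auto simp: finite_defects_def finite_rank_def)
  have 1: "id_blinfun - (H o\<^sub>L (T + F)) = (id_blinfun - (H o\<^sub>L T)) + (- (H o\<^sub>L F))"
    by (rule blinfun_eqI) (simp add: blinfun.bilinear_simps)
  have 2: "id_blinfun - ((T + F) o\<^sub>L H) = (id_blinfun - (T o\<^sub>L H)) + (- (F o\<^sub>L H))"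
    by (rule blinfun_eqI) (simp add: blinfun.bilinear_simps)
  have "finite_rank (id_blinfun - (H o\<^sub>L (T + F)))"
    unfolding 1 by (intro finite_rank_add H(2) finite_rank_uminus finite_rank_compose_left F H(1))
  moreover have "finite_rank (id_blinfun - ((T + F) o\<^sub>L H))"
    unfolding 2 by (intro finite_rank_add H(3) finite_rank_uminus finite_rank_compose_right F H(1))
  ultimately show ?thesis
    by (rule finite_defects_of_parametrices[OF bounded_ops_add[OF T Fb]])
qed

section \<open>Essentially incomparable spaces\<close>

lemma finite_defects_inessential:
  assumes "R \<in> inessential_ops" and "V \<in> bounded_ops"
  shows "finite_defects (id_blinfun - (V o\<^sub>L R))"
  using assms Fredholm_finite_defects by (auto simp: inessential_ops_def)

text \<open>Modulo finite rank, a parametrix of \<open>I - VR\<close> turns \<open>I - VR - V'R'\<close> into the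
  identity minus a single product through the other space.\<close>

lemma finite_defects_inessential_sum:
  fixes V V' :: "'y::cbanach \<Rightarrow>\<^sub>L 'x::cbanach" and R R' :: "'x \<Rightarrow>\<^sub>L 'y"
  assumes ess: "(bounded_ops :: ('x \<Rightarrow>\<^sub>L 'y) set) = inessential_ops"
    and V: "V \<in> bounded_ops" "V' \<in> bounded_ops" and R: "R \<in> bounded_ops" "R' \<in> bounded_ops"
  shows "finite_defects (id_blinfun - ((V o\<^sub>L R) + (V' o\<^sub>L R')))"
proof -
  have prod: "finite_defects (id_blinfun - (W o\<^sub>L S))" if "W \<in> bounded_ops" "S \<in> bounded_ops"
    for W :: "'y \<Rightarrow>\<^sub>L 'x" and S :: "'x \<Rightarrow>\<^sub>L 'y"
    using finite_defects_inessential[of S W] that ess by simp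
  let ?T = "id_blinfun - ((V o\<^sub>L R) + (V' o\<^sub>L R'))"
  obtain H where H: "H \<in> bounded_ops"
    and F: "finite_rank (id_blinfun - (H o\<^sub>L (id_blinfun - (V o\<^sub>L R))))"
    and F': "finite_rank (id_blinfun - ((id_blinfun - (V o\<^sub>L R)) o\<^sub>L H))"
    using parametrix_exists[OF prod[OF V(1) R(1)]] by metis
  have T: "?T \<in> bounded_ops" using V R by (intro bounded_ops_intros)
  have left: "H o\<^sub>L ?T = (id_blinfun - ((H o\<^sub>L V') o\<^sub>L R')) +
      (- (id_blinfun - (H o\<^sub>L (id_blinfun - (V o\<^sub>L R)))))"
    by (rule blinfun_eqI) (simp add: blinfun.bilinear_simps)
  have right: "?T o\<^sub>L H = (id_blinfun - (V' o\<^sub>L (R' o\<^sub>L H))) +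
      (- (id_blinfun - ((id_blinfun - (V o\<^sub>L R)) o\<^sub>L H)))"
    by (rule blinfun_eqI) (simp add: blinfun.bilinear_simps)
  show ?thesis
  proof (rule finite_defects_of_products[OF T H H])
    show "finite_defects (H o\<^sub>L ?T)"
      unfolding left by (intro finite_defects_add_finite_rank prod finite_rank_uminus F bounded_ops_compose H V R)
    show "finite_defects (?T o\<^sub>L H)"
      unfolding right by (intro finite_defects_add_finite_rank prod finite_rank_uminus F' bounded_ops_compose H V R)
  qed
qed

definition inl_blinfun :: "'a::real_normed_vector \<Rightarrow>\<^sub>L ('a \<times> 'b::real_normed_vector)" where
  "inl_blinfun = Blinfun (\<lambda>x. (x, 0))"

definition inr_blinfun :: "'b::real_normed_vector \<Rightarrow>\<^sub>L ('a::real_normed_vector \<times> 'b)" where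
  "inr_blinfun = Blinfun (\<lambda>y. (0, y))"

lemma inl_blinfun_apply: "blinfun_apply inl_blinfun x = (x, 0)"
  unfolding inl_blinfun_def
  by (simp add: bounded_linear_Blinfun_apply bounded_linear_Pair bounded_linear_ident bounded_linear_zero)

lemma inr_blinfun_apply: "blinfun_apply inr_blinfun y = (0, y)"
  unfolding inr_blinfun_def
  by (simp add: bounded_linear_Blinfun_apply bounded_linear_Pair bounded_linear_ident bounded_linear_zero)

definition corner12 :: "('a::cbanach \<times> 'b::cbanach) \<Rightarrow>\<^sub>L ('a \<times> 'b) \<Rightarrow> 'b \<Rightarrow>\<^sub>L 'a" where
  "corner12 U = fst_blinfun o\<^sub>L (U o\<^sub>L inr_blinfun)"

definition corner21 :: "('a::cbanach \<times> 'b::cbanach) \<Rightarrow>\<^sub>L ('a \<times> 'b) \<Rightarrow> 'a \<Rightarrow>\<^sub>L 'b" where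
  "corner21 U = snd_blinfun o\<^sub>L (U o\<^sub>L inl_blinfun)"

lemma corner11_eq: "corner11 U = fst_blinfun o\<^sub>L (U o\<^sub>L inl_blinfun)"
  by (rule blinfun_eqI) (simp add: corner11.rep_eq inl_blinfun_apply)

lemma bounded_ops_corners:
  assumes "U \<in> bounded_ops"
  shows "corner11 U \<in> bounded_ops" and "corner12 U \<in> bounded_ops" and "corner21 U \<in> bounded_ops"
proof -
  have "inl_blinfun \<in> bounded_ops" "inr_blinfun \<in> bounded_ops"
    "fst_blinfun \<in> bounded_ops" "snd_blinfun \<in> bounded_ops"
    by (auto simp: bounded_ops_def inl_blinfun_apply inr_blinfun_apply scaleC_prod_def)
  then show "corner11 U \<in> bounded_ops" "corner12 U \<in> bounded_ops" "corner21 U \<in> bounded_ops"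
    using assms unfolding corner11_eq corner12_def corner21_def by (auto intro!: bounded_ops_compose)
qed

lemma corner11_compose:
  "corner11 (U o\<^sub>L V) = (corner11 U o\<^sub>L corner11 V) + (corner12 U o\<^sub>L corner21 V)"
proof (rule blinfun_eqI)
  fix x
  let ?p = "blinfun_apply V (x, 0)"
  have "blinfun_apply U ?p = blinfun_apply U (fst ?p, 0) + blinfun_apply U (0, snd ?p)"
    by (simp flip: blinfun.add_right)
  then show "blinfun_apply (corner11 (U o\<^sub>L V)) x =
      blinfun_apply ((corner11 U o\<^sub>L corner11 V) + (corner12 U o\<^sub>L corner21 V)) x"
    by (simp add: corner11_eq corner12_def corner21_def blinfun.add_left
        inl_blinfun_apply inr_blinfun_apply)
qed

lemma corner11_diff: "corner11 (U - V) = corner11 U - corner11 V"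
  by (rule blinfun_eqI) (simp add: corner11.rep_eq blinfun.diff_left)

lemma corner11_id: "corner11 id_blinfun = id_blinfun"
  by (rule blinfun_eqI) (simp add: corner11.rep_eq)

text \<open>The corner \<open>V\<^sub>1\<^sub>1\<close> of the inverse is a parametrix up to products through the other
  space, and adding such a product keeps it one.\<close>

lemma finite_defects_corner11_perturbed:
  fixes U :: "('x::cbanach \<times> 'y::cbanach) \<Rightarrow>\<^sub>L ('x \<times> 'y)"
    and P :: "'y \<Rightarrow>\<^sub>L 'x" and Q :: "'x \<Rightarrow>\<^sub>L 'y"
  assumes ess: "essentially_incomparable TYPE('x) TYPE('y)" and U: "U \<in> Inv"
    and PQ: "P \<in> bounded_ops" "Q \<in> bounded_ops"
  shows "finite_defects (corner11 U + (P o\<^sub>L Q))"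
proof -
  have ess': "(bounded_ops :: ('x \<Rightarrow>\<^sub>L 'y) set) = inessential_ops"
    using ess by (simp add: essentially_incomparable_def)
  obtain V where Ub: "U \<in> bounded_ops" and V: "V \<in> bounded_ops" "U o\<^sub>L V = id_blinfun" "V o\<^sub>L U = id_blinfun"
    using U by (auto simp: Inv_def)
  note b = bounded_ops_corners[OF Ub] bounded_ops_corners[OF V(1)]
  let ?S = "corner11 U + (P o\<^sub>L Q)"
  have S: "?S \<in> bounded_ops" using b PQ by (intro bounded_ops_intros)
  have mP: "(- 1) *\<^sub>R W \<in> bounded_ops" if "W \<in> bounded_ops" for W :: "'y \<Rightarrow>\<^sub>L 'x"
    using that by (rule bounded_ops_scaleR)
  have UV: "corner11 U o\<^sub>L corner11 V = id_blinfun - (corner12 U o\<^sub>L corner21 V)"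
    using corner11_compose[of U V] by (simp add: V corner11_id eq_diff_eq)
  have VU: "corner11 V o\<^sub>L corner11 U = id_blinfun - (corner12 V o\<^sub>L corner21 U)"
    using corner11_compose[of V U] by (simp add: V corner11_id eq_diff_eq)
  have right: "?S o\<^sub>L corner11 V = id_blinfun -
      ((corner12 U o\<^sub>L corner21 V) + (((- 1) *\<^sub>R P) o\<^sub>L (Q o\<^sub>L corner11 V)))"
  proof -
    have "?S o\<^sub>L corner11 V = (corner11 U o\<^sub>L corner11 V) + (P o\<^sub>L (Q o\<^sub>L corner11 V))"
      by (rule blinfun_eqI) (simp add: blinfun.bilinear_simps)
    also have "\<dots> = id_blinfun -
      ((corner12 U o\<^sub>L corner21 V) + (((- 1) *\<^sub>R P) o\<^sub>L (Q o\<^sub>L corner11 V)))"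
      unfolding UV by (rule blinfun_eqI) (simp add: blinfun.bilinear_simps)
    finally show ?thesis .
  qed
  have left: "corner11 V o\<^sub>L ?S = id_blinfun -
      ((corner12 V o\<^sub>L corner21 U) + (((- 1) *\<^sub>R (corner11 V o\<^sub>L P)) o\<^sub>L Q))"
  proof -
    have "corner11 V o\<^sub>L ?S = (corner11 V o\<^sub>L corner11 U) + ((corner11 V o\<^sub>L P) o\<^sub>L Q)"
      by (rule blinfun_eqI) (simp add: blinfun.bilinear_simps)
    also have "\<dots> = id_blinfun -
      ((corner12 V o\<^sub>L corner21 U) + (((- 1) *\<^sub>R (corner11 V o\<^sub>L P)) o\<^sub>L Q))"
      unfolding VU by (rule blinfun_eqI) (simp add: blinfun.bilinear_simps)
    finally show ?thesis .
  qed
  show ?thesis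
  proof (rule finite_defects_of_products[OF S b(4) b(4)])
    show "finite_defects (corner11 V o\<^sub>L ?S)"
      unfolding left by (intro finite_defects_inessential_sum ess' mP bounded_ops_compose b PQ)
    show "finite_defects (?S o\<^sub>L corner11 V)"
      unfolding right by (intro finite_defects_inessential_sum ess' mP bounded_ops_compose b PQ)
  qed
qed

lemma finite_defects_corner11:
  fixes U :: "('x::cbanach \<times> 'y::cbanach) \<Rightarrow>\<^sub>L ('x \<times> 'y)"
  assumes "essentially_incomparable TYPE('x) TYPE('y)" and "U \<in> Inv"
  shows "finite_defects (corner11 U)"
proof -
  have "(0 :: 'y \<Rightarrow>\<^sub>L 'x) \<in> bounded_ops" "(0 :: 'x \<Rightarrow>\<^sub>L 'y) \<in> bounded_ops"
    by (simp_all add: bounded_ops_def)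
  from finite_defects_corner11_perturbed[OF assms this] show ?thesis by simp
qed

text \<open>The segment from \<open>U\<^sub>1\<^sub>1\<close> to \<open>U\<^sub>1\<^sub>1 + PQ\<close> consists of Fredholm operators, and the
  index cannot jump along it.\<close>

lemma ind_corner11_perturbed:
  fixes U :: "('x::cbanach \<times> 'y::cbanach) \<Rightarrow>\<^sub>L ('x \<times> 'y)"
    and P :: "'y \<Rightarrow>\<^sub>L 'x" and Q :: "'x \<Rightarrow>\<^sub>L 'y"
  assumes "essentially_incomparable TYPE('x) TYPE('y)" and "U \<in> Inv"
    and "P \<in> bounded_ops" and "Q \<in> bounded_ops"
  shows "ind (corner11 U + (P o\<^sub>L Q)) = ind (corner11 U)"
proof -
  define S where "S t = corner11 U + t *\<^sub>R (P o\<^sub>L Q)" for t :: real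
  have S: "S t = corner11 U + ((t *\<^sub>R P) o\<^sub>L Q)" for t
    unfolding S_def by (rule blinfun_eqI) (simp add: blinfun.bilinear_simps)
  have "ind (S 1) = ind (S 0)"
  proof (rule ind_constant_on_connected[of "{0..1}"])
    show "continuous_on {0..1} S" unfolding S_def by (intro continuous_intros)
    show "finite_defects (S t)" for t
      unfolding S using assms by (intro finite_defects_corner11_perturbed bounded_ops_scaleR)
  qed auto
  then show ?thesis by (simp add: S_def)
qed

text \<open>The corner of \<open>I - AB\<close> is \<open>I - A\<^sub>1\<^sub>1 B\<^sub>1\<^sub>1 - A\<^sub>1\<^sub>2 B\<^sub>2\<^sub>1\<close>, and its last term
  factors through the other space.  Dropping it leaves an expression in which the two factors can be
  exchanged by linear algebra.\<close>

lemma phi_id_minus_product: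
  fixes A B :: "('x::cbanach \<times> 'y::cbanach) \<Rightarrow>\<^sub>L ('x \<times> 'y)"
  assumes ess: "essentially_incomparable TYPE('x) TYPE('y)"
    and AB: "A \<in> bounded_ops" "B \<in> bounded_ops" and inv: "id_blinfun - (A o\<^sub>L B) \<in> Inv"
  shows "finite_defects (id_blinfun - (corner11 A o\<^sub>L corner11 B))"
    and "\<phi> (id_blinfun - (A o\<^sub>L B)) = ind (id_blinfun - (corner11 A o\<^sub>L corner11 B))"
proof -
  have eq: "id_blinfun - (corner11 A o\<^sub>L corner11 B) =
      corner11 (id_blinfun - (A o\<^sub>L B)) + (corner12 A o\<^sub>L corner21 B)"
    by (simp add: corner11_diff corner11_id corner11_compose)
  note b = bounded_ops_corners(2)[OF AB(1)] bounded_ops_corners(3)[OF AB(2)]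
  show "finite_defects (id_blinfun - (corner11 A o\<^sub>L corner11 B))"
    unfolding eq by (rule finite_defects_corner11_perturbed[OF ess inv b])
  show "\<phi> (id_blinfun - (A o\<^sub>L B)) = ind (id_blinfun - (corner11 A o\<^sub>L corner11 B))"
    unfolding eq \<phi>_def by (rule ind_corner11_perturbed[OF ess inv b, symmetric])
qed

lemma Inv_id_minus_swap:
  assumes AB: "A \<in> bounded_ops" "B \<in> bounded_ops" and inv: "id_blinfun - (A o\<^sub>L B) \<in> Inv"
  shows "id_blinfun - (B o\<^sub>L A) \<in> Inv"
proof -
  obtain V where V: "V \<in> bounded_ops" and r: "(id_blinfun - (A o\<^sub>L B)) o\<^sub>L V = id_blinfun"
    and l: "V o\<^sub>L (id_blinfun - (A o\<^sub>L B)) = id_blinfun"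
    using inv by (auto simp: Inv_def)
  have r': "blinfun_apply A (blinfun_apply B (blinfun_apply V x)) = blinfun_apply V x - x" for x
    using arg_cong[OF r, of "\<lambda>T. blinfun_apply T x"] by (simp add: blinfun.bilinear_simps algebra_simps)
  have l': "blinfun_apply V (blinfun_apply A (blinfun_apply B x)) = blinfun_apply V x - x" for x
    using arg_cong[OF l, of "\<lambda>T. blinfun_apply T x"] by (simp add: blinfun.bilinear_simps algebra_simps)
  \<comment> \<open>Formally \<open>(I - BA)\<^sup>-\<^sup>1 = I + BA + BABA + \<dots> = I + B (I - AB)\<^sup>-\<^sup>1 A\<close>.\<close>
  let ?W = "id_blinfun + (B o\<^sub>L (V o\<^sub>L A))"
  have "(id_blinfun - (B o\<^sub>L A)) o\<^sub>L ?W = id_blinfun"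
    by (rule blinfun_eqI) (simp add: blinfun.bilinear_simps r')
  moreover have "?W o\<^sub>L (id_blinfun - (B o\<^sub>L A)) = id_blinfun"
    by (rule blinfun_eqI) (simp add: blinfun.bilinear_simps l')
  moreover have "?W \<in> bounded_ops" "id_blinfun - (B o\<^sub>L A) \<in> bounded_ops"
    using AB V by (auto intro!: bounded_ops_intros)
  ultimately show ?thesis by (auto simp: Inv_def)
qed

lemma phi_id: "\<phi> (id_blinfun :: ('a::cbanach \<times> 'b::cbanach) \<Rightarrow>\<^sub>L ('a \<times> 'b)) = 0"
proof -
  have "complementary (UNIV :: 'a set) {0}"
    by (auto simp: complementary_def set_plus_def)
  then have "ind (id_blinfun :: 'a \<Rightarrow>\<^sub>L 'a) = 0"
    using ind_eq_complement[of "id_blinfun :: 'a \<Rightarrow>\<^sub>L 'a" "{0}"] fin_dim_zero by (simp add: ker_def)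
  then show ?thesis by (simp add: \<phi>_def corner11_id)
qed

lemma phi_Inv0:
  fixes U :: "('x::cbanach \<times> 'y::cbanach) \<Rightarrow>\<^sub>L ('x \<times> 'y)"
  assumes ess: "essentially_incomparable TYPE('x) TYPE('y)" and U: "U \<in> Inv0"
  shows "\<phi> U = 0"
proof -
  obtain S where S: "connected S" "S \<subseteq> Inv" "id_blinfun \<in> S" "U \<in> S"
    using U by (auto simp: Inv0_def connected_component_def)
  have "ind (corner11 U) = ind (corner11 (id_blinfun :: ('x \<times> 'y) \<Rightarrow>\<^sub>L ('x \<times> 'y)))"
  proof (rule ind_constant_on_connected[OF S(1,4,3), of corner11])
    show "continuous_on S corner11"
      unfolding corner11_eq[abs_def]
      by (intro bounded_bilinear.continuous_on[OF bounded_bilinear_blinfun_compose] continuous_intros)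
    show "finite_defects (corner11 T)" if "T \<in> S" for T
      using that S(2) by (intro finite_defects_corner11[OF ess]) auto
  qed
  then show ?thesis using phi_id[where ?'a = 'x and ?'b = 'y] by (simp add: \<phi>_def)
qed

theorem proposition8p5:
  fixes A B :: "('x::cbanach \<times> 'y::cbanach) \<Rightarrow>\<^sub>L ('x \<times> 'y)"
  assumes "essentially_incomparable TYPE('x) TYPE('y)"
    and "A \<in> bounded_ops" and "B \<in> bounded_ops"
  shows "(id_blinfun - (A o\<^sub>L B) \<in> Inv \<longrightarrow>
            id_blinfun - (B o\<^sub>L A) \<in> Inv \<and>
            \<phi> (id_blinfun - (A o\<^sub>L B)) = \<phi> (id_blinfun - (B o\<^sub>L A))) \<and>
         (id_blinfun - (B o\<^sub>L A) \<in> Inv0 \<longrightarrow> \<phi> (id_blinfun - (A o\<^sub>L B)) = 0)"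
proof -
  have swap: "id_blinfun - (D o\<^sub>L C) \<in> Inv \<and>
      \<phi> (id_blinfun - (C o\<^sub>L D)) = \<phi> (id_blinfun - (D o\<^sub>L C))"
    if CD: "C \<in> bounded_ops" "D \<in> bounded_ops" and inv: "id_blinfun - (C o\<^sub>L D) \<in> Inv"
    for C D :: "('x \<times> 'y) \<Rightarrow>\<^sub>L ('x \<times> 'y)"
  proof
    show inv': "id_blinfun - (D o\<^sub>L C) \<in> Inv"
      by (rule Inv_id_minus_swap[OF CD inv])
    show "\<phi> (id_blinfun - (C o\<^sub>L D)) = \<phi> (id_blinfun - (D o\<^sub>L C))"
      using phi_id_minus_product(2)[OF assms(1) CD inv]
        phi_id_minus_product(2)[OF assms(1) CD(2,1) inv']
        ind_swap[OF bounded_ops_corners(1)[OF CD(1)] bounded_ops_corners(1)[OF CD(2)]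
          phi_id_minus_product(1)[OF assms(1) CD inv]]
      by simp
  qed
  have "\<phi> (id_blinfun - (A o\<^sub>L B)) = 0" if "id_blinfun - (B o\<^sub>L A) \<in> Inv0"
  proof -
    have "id_blinfun - (B o\<^sub>L A) \<in> Inv"
      using that connected_component_subset by (auto simp: Inv0_def)
    then show ?thesis
      using swap[OF assms(3,2)] phi_Inv0[OF assms(1) that] by simp
  qed
  then show ?thesis using swap[OF assms(2,3)] by blast
qed

end
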